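(* Let $d\ge1$, let $\mu$ be a probability measure on $\mathbb{R}^d$ with characteristic function $\varphi$, and let $(X_n)$ be a sequence of $\mathbb{R}^d$-valued random variables for which mod-$\varphi$ convergence holds, with associated linear automorphisms $A_n\in\mathrm{GL}_d(\mathbb{R})$. Then for every continuous function $f$ on $\mathbb{R}^d$ with compact support, $$|\det(A_n)|\,\mathbb{E}[f(X_n)]\longrightarrow\frac{d\mu}{dm}(0)\int_{\mathbb{R}^d}f\,dm\qquad(n\to+\infty).$$ Consequently, for every relatively compact Borel set $B\subset\mathbb{R}^d$ with $m(\partial B)=0$ (that is, for every bounded Jordan-measurable set $B\subset\mathbb{R}^d$), $$|\det(A_n)|\,\mathbb{P}[X_n\in B]\longrightarrow\frac{d\mu}{dm}(0)\,m(B)\qquad(n\to+\infty).$$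
   Context: $m$ is Lebesgue measure on $\mathbb{R}^d$, $|\cdot|$ the Euclidean norm, and $A^*$ the transpose of $A$. Let $\varphi_n(t)=\mathbb{E}[e^{it\cdot X_n}]$. Mod-$\varphi$ convergence holds for $(X_n)$, with linear automorphisms $A_n\in\mathrm{GL}_d(\mathbb{R})$ and inverses $\Sigma_n=A_n^{-1}$, if: (H1) the characteristic function $\varphi$ of $\mu$ is integrable on $\mathbb{R}^d$; in particular $\mu$ has a density $\frac{d\mu}{dm}$ with respect to $m$, always taken to be the continuous version $\frac{d\mu}{dm}(x)=(2\pi)^{-d}\int e^{-it\cdot x}\varphi(t)\,m(dt)$; (H2) $\Sigma_n\to0$ and $\varphi_n(\Sigma_n^*t)\to\varphi(t)$ uniformly for $t$ in compact sets (equivalently, $\Sigma_n(X_n)$ converges in law to $\mu$); (H3) for all $k\ge0$, the sequence $f_{n,k}(t)=\varphi_n(\Sigma_n^*t)\mathbf{1}_{|\Sigma_n^*t|\le k}$ is uniformly integrable on $\mathbb{R}^d$, i.e. $\lim_{a\to+\infty}\sup_{n\ge1}\int_{|t|\ge a}|\varphi_n(\Sigma_n^*t)|\mathbf{1}_{|\Sigma_n^*t|\le k}\,m(dt)=0$. *)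

theory Defs
  imports "HOL-Probability.Probability"
begin

definition char_fun :: "(real ^ 'd) measure \<Rightarrow> real ^ 'd \<Rightarrow> complex" where
  "char_fun \<mu> t = (CLINT x|\<mu>. iexp (t \<bullet> x))"

definition is_continuous_density :: "(real ^ 'd) measure \<Rightarrow> (real ^ 'd \<Rightarrow> real) \<Rightarrow> bool" where
  "is_continuous_density \<mu> p \<longleftrightarrow>
     continuous_on UNIV p \<and> (\<forall>x. 0 \<le> p x) \<and> \<mu> = density lborel (\<lambda>x. ennreal (p x))"

text \<open>A continuous Lebesgue density is unique (next lemma). If \<open>\<mu>\<close> is a probability measure whose
  characteristic function is Lebesgue integrable, Fourier inversion shows that it exists and is
  the function \<open>x \<mapsto> (2 * pi) powr (- CARD('d)) * (CLINT t|lborel. iexp (- (t \<bullet> x)) * char_fun \<mu> t)\<close>,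
  so the description below then denotes it.\<close>

definition continuous_density :: "(real ^ 'd) measure \<Rightarrow> real ^ 'd \<Rightarrow> real" where
  "continuous_density \<mu> = (THE p. is_continuous_density \<mu> p)"

lemma is_continuous_density_unique:
  fixes p q :: "real ^ 'd \<Rightarrow> real"
  assumes p: "is_continuous_density \<mu> p" and q: "is_continuous_density \<mu> q"
  shows "p = q"
proof -
  have cont: "continuous_on UNIV p" "continuous_on UNIV q"
    and nonneg: "\<And>x. 0 \<le> p x" "\<And>x. 0 \<le> q x"
    and eq: "density lborel (\<lambda>x. ennreal (p x)) = density lborel (\<lambda>x. ennreal (q x))"
    using p q by (auto simp: is_continuous_density_def)
  have [measurable]: "p \<in> borel_measurable borel" "q \<in> borel_measurable borel"
    using cont by (auto intro: borel_measurable_continuous_onI)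
  have "AE x in lborel. ennreal (p x) = ennreal (q x)"
    using eq by (subst (asm) sigma_finite_measure.density_unique_iff[OF sigma_finite_lborel]) auto
  then have ae: "AE x in lborel. p x = q x"
    by eventually_elim (simp add: nonneg)
  have "open {x. p x \<noteq> q x}"
    using cont by (intro open_Collect_neq) auto
  moreover have "{x. p x \<noteq> q x} \<in> null_sets lborel"
    using ae by (subst (asm) AE_iff_null) auto
  ultimately have "{x. p x \<noteq> q x} = {}"
    using open_not_negligible null_sets_completionI
    by (metis negligible_iff_null_sets)
  then show ?thesis by auto
qed

lemma continuous_density_eq: "is_continuous_density \<mu> p \<Longrightarrow> continuous_density \<mu> = p"
  unfolding continuous_density_def by (blast intro: the_equality is_continuous_density_unique)

text \<open>Each \<open>X n\<close> may live on its own probability space \<open>M n\<close>; only the laws matter.\<close>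

definition mod_phi_convergence ::
  "(real ^ 'd) measure \<Rightarrow> (nat \<Rightarrow> 'a measure) \<Rightarrow> (nat \<Rightarrow> 'a \<Rightarrow> real ^ 'd) \<Rightarrow>
   (nat \<Rightarrow> real ^ 'd ^ 'd) \<Rightarrow> bool" where
  "mod_phi_convergence \<mu> M X A \<longleftrightarrow>
     (let \<Sigma> = (\<lambda>n. matrix_inv (A n));
          \<psi> = (\<lambda>n t. char_fun (distr (M n) borel (X n)) (transpose (\<Sigma> n) *v t))
      in (\<forall>n. invertible (A n)) \<and>
         integrable lborel (char_fun \<mu>) \<and>
         \<Sigma> \<longlonglongrightarrow> 0 \<and>
         (\<forall>K. compact K \<longrightarrow> uniform_limit K \<psi> (char_fun \<mu>) sequentially) \<and>
         (\<forall>k\<ge>0::real.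
            ((\<lambda>a::real. SUP n. \<integral>\<^sup>+ t \<in> {t. a \<le> norm t}.
                 ennreal (cmod (\<psi> n t) * indicator {t. norm (transpose (\<Sigma> n) *v t) \<le> k} t)
               \<partial>lborel) \<longlongrightarrow> 0) at_top))"

end

theory Submission
  imports Defs
begin

text \<open>Write \<open>\<phi>\<^sub>n\<close> for the characteristic function of \<open>X\<^sub>n\<close>, \<open>\<phi>\<close> for that of \<open>\<mu>\<close>, \<open>p\<close> for the
  continuous density of \<open>\<mu>\<close> and \<open>d\<close> for the dimension. Uniform integrability controls \<open>\<phi>\<^sub>n\<close> only behind
  a compactly supported window, so the natural first test functions are those with a compactly
  supported Fourier transform. If \<open>f x = (\<integral>u. g u * iexp (u \<bullet> x))\<close> with \<open>g\<close> continuous of compact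
  support, then Fubini and the substitution \<open>u = transpose (\<Sigma>\<^sub>n) *v t\<close> give
  \<open>\<bar>det A\<^sub>n\<bar> * E f(X\<^sub>n) = (\<integral>t. g (transpose (\<Sigma>\<^sub>n) *v t) * \<phi>\<^sub>n (transpose (\<Sigma>\<^sub>n) *v t))\<close>.
  On a large ball the integrand tends to \<open>g 0 * \<phi> t\<close> boundedly, and outside it the integral is small
  uniformly in \<open>n\<close>; hence the limit is \<open>g 0 * (\<integral>\<phi>) = g 0 * (2 * pi) ^ d * p 0\<close>
  (\<open>window_limit\<close>), which by Fourier inversion of \<open>f\<close> equals \<open>p 0 * (\<integral>f)\<close>.

  To reach every continuous \<open>f\<close> with compact support, fix a product \<open>H\<close> of Fejer kernels: it is
  nonnegative and integrable, its Fourier transform is a product of tent functions, and with a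
  suitable scale it is positive on the support of \<open>f\<close>. Multiplying \<open>H\<close> by \<open>iexp (s \<bullet> x)\<close> only
  translates the window, so the previous step says that the finite measures
  \<open>\<bar>det A\<^sub>n\<bar> * H * law(X\<^sub>n)\<close> have characteristic functions converging pointwise to that of the measure
  with density \<open>p 0 * H\<close> (\<open>fejer_kernel_char_limit\<close>). The continuity theorem for
  characteristic functions (\<open>char_fun_continuity_vague\<close>), applied to the test function
  \<open>f / H\<close>, yields the first claim (\<open>vague_local_limit\<close>). A bounded Jordan measurable set is
  squeezed between continuous functions of compact support (\<open>vague_limit_Jordan\<close>).

  The continuity theorem and Fourier inversion in dimension \<open>d\<close> are both obtained by Gaussian
  smoothing: the smoothed density of a finite measure is an absolutely convergent integral of its
  characteristic function (\<open>gauss_smoothed_measure_fourier\<close>), and smoothing moves a test function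
  uniformly little (\<open>gauss_smoothing_uniform\<close>). The change of variables for an invertible matrix is
  proved by reduction to elementary matrices (\<open>nn_integral_lborel_linear\<close>).\<close>

section \<open>Lebesgue measure on real vectors and invertible matrices\<close>

lemma Basis_vec_real: "(Basis :: (real^'d) set) = range (\<lambda>i. axis i 1)"
  by (auto simp: Basis_vec_def)

lemma prod_Basis_vec:
  "(\<Prod>b\<in>(Basis :: (real^'d) set). h b) = (\<Prod>i\<in>UNIV. h (axis i 1))"
  unfolding Basis_vec_real by (subst prod.reindex) (auto simp: inj_on_def axis_eq_axis)

lemma box_vec_eq: "box l u = {x :: real^'d. \<forall>i. l $ i < x $ i \<and> x $ i < u $ i}"
  by (auto simp: mem_box_cart)

lemma lborel_vec_eqI:
  fixes M :: "(real^'d) measure"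
  assumes "\<And>l u. (\<And>i. l $ i \<le> u $ i) \<Longrightarrow>
      emeasure M {x. \<forall>i. l $ i < x $ i \<and> x $ i < u $ i} = (\<Prod>i\<in>UNIV. u $ i - l $ i)"
    and "sets M = sets borel"
  shows "lborel = M"
proof (rule lborel_eqI)
  fix l u :: "real^'d" assume le: "\<And>b. b \<in> Basis \<Longrightarrow> l \<bullet> b \<le> u \<bullet> b"
  have "l $ i \<le> u $ i" for i
    using le[of "axis i 1"] by (simp add: inner_axis)
  from assms(1)[OF this]
  show "emeasure M (box l u) = ennreal (\<Prod>b\<in>Basis. (u - l) \<bullet> b)"
    by (simp add: prod_Basis_vec inner_axis flip: box_vec_eq)
qed (use assms in simp)

lemma emeasure_lborel_vec_box:
  fixes l u :: "real^'d"
  assumes "\<And>i. l $ i \<le> u $ i"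
  shows "emeasure lborel {x. \<forall>i. l $ i < x $ i \<and> x $ i < u $ i} = (\<Prod>i\<in>UNIV. u $ i - l $ i)"
proof -
  have "emeasure lborel (box l u) = ennreal (\<Prod>b\<in>Basis. (u - l) \<bullet> b)"
    using assms by (intro emeasure_lborel_box) (auto simp: Basis_vec_real inner_axis)
  then show ?thesis
    by (simp add: prod_Basis_vec inner_axis flip: box_vec_eq)
qed

lemma borel_measurable_vec_nth [measurable (raw)]:
  fixes f :: "'a \<Rightarrow> real^'d"
  assumes [measurable]: "f \<in> borel_measurable N"
  shows "(\<lambda>x. f x $ i) \<in> borel_measurable N"
proof -
  have [measurable]: "(\<lambda>v::real^'d. v $ i) \<in> borel_measurable borel"
    by (intro borel_measurable_continuous_onI continuous_intros)
  show ?thesis by measurable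
qed

lemma borel_measurable_vec_lambda:
  fixes f :: "'a \<Rightarrow> 'd::finite \<Rightarrow> real"
  assumes "\<And>i. (\<lambda>x. f x i) \<in> borel_measurable N"
  shows "(\<lambda>x. \<chi> i. f x i) \<in> borel_measurable N"
  by (subst borel_measurable_euclidean_space) (auto simp: Basis_vec_real inner_axis assms)

lemma measurable_vec_lambda_PiM [measurable]:
  "vec_lambda \<in> borel_measurable (\<Pi>\<^sub>M i\<in>(UNIV :: 'd::finite set). (lborel :: real measure))"
proof -
  have "(\<lambda>g. \<chi> i. g i) \<in> borel_measurable (\<Pi>\<^sub>M i\<in>(UNIV :: 'd::finite set). (lborel :: real measure))"
    by (intro borel_measurable_vec_lambda) measurable
  then show ?thesis by simp
qed

text \<open>Indexing the coordinates by the finite type itself, rather than by basis vectors, makes Fubini in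
  one coordinate and products over coordinates directly available.\<close>

lemma lborel_vec_eq_PiM:
  "(lborel :: (real^'d) measure) = distr (\<Pi>\<^sub>M i\<in>UNIV. lborel) borel vec_lambda"
proof (rule lborel_vec_eqI)
  interpret product_sigma_finite "\<lambda>_::'d. lborel :: real measure"
    by standard
  fix l u :: "real^'d" assume le: "\<And>i. l $ i \<le> u $ i"
  have [measurable]: "{x::real^'d. \<forall>i. l $ i < x $ i \<and> x $ i < u $ i} \<in> sets borel"
    by measurable
  have "vec_lambda -` {x::real^'d. \<forall>i. l $ i < x $ i \<and> x $ i < u $ i}
      \<inter> space (\<Pi>\<^sub>M i\<in>(UNIV::'d set). lborel) = (\<Pi>\<^sub>E i\<in>UNIV. {l $ i <..< u $ i})"
    by (auto simp: space_PiM PiE_iff extensional_def)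
  then show "emeasure (distr (\<Pi>\<^sub>M i\<in>UNIV. lborel) borel vec_lambda)
      {x::real^'d. \<forall>i. l $ i < x $ i \<and> x $ i < u $ i} = (\<Prod>i\<in>UNIV. u $ i - l $ i)"
    using le by (simp add: emeasure_distr emeasure_PiM prod_ennreal)
qed simp

lemma integral_vec_prod:
  fixes f :: "'d::finite \<Rightarrow> real \<Rightarrow> 'c::{real_normed_field,banach,second_countable_topology}"
  assumes "\<And>i. integrable lborel (f i)"
  shows integrable_vec_prod: "integrable lborel (\<lambda>x::real^'d. \<Prod>i\<in>UNIV. f i (x $ i))"
    and "(\<integral>x. (\<Prod>i\<in>UNIV. f i (x $ i)) \<partial>(lborel :: (real^'d) measure)) = (\<Prod>i\<in>UNIV. \<integral>t. f i t \<partial>lborel)"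
proof -
  interpret product_sigma_finite "\<lambda>_::'d. lborel :: real measure"
    by standard
  have [measurable]: "f i \<in> borel_measurable borel" for i
    using assms[of i] by (auto dest: borel_measurable_integrable)
  have m: "(\<lambda>x::real^'d. \<Prod>i\<in>UNIV. f i (x $ i)) \<in> borel_measurable borel"
    by measurable
  show "integrable lborel (\<lambda>x::real^'d. \<Prod>i\<in>UNIV. f i (x $ i))"
    unfolding lborel_vec_eq_PiM
    by (subst integrable_distr_eq[OF _ m]) (auto intro!: product_integrable_prod assms)
  show "(\<integral>x. (\<Prod>i\<in>UNIV. f i (x $ i)) \<partial>(lborel :: (real^'d) measure)) = (\<Prod>i\<in>UNIV. \<integral>t. f i t \<partial>lborel)"
    unfolding lborel_vec_eq_PiM
    by (subst integral_distr[OF _ m]) (auto intro!: product_integral_prod assms)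
qed

lemma borel_measurable_linear_vec:
  fixes h :: "real^'d \<Rightarrow> real^'d"
  assumes "linear h" shows "h \<in> borel_measurable borel"
  using assms by (simp add: borel_measurable_continuous_onI linear_continuous_on linear_conv_bounded_linear)

text \<open>For fixed values of the other coordinates the shear is a translation of coordinate \<open>m\<close>, so the
  claim is Fubini together with translation invariance on the line.\<close>

lemma nn_integral_lborel_shear:
  fixes f :: "real^'d \<Rightarrow> ennreal" and m n :: 'd
  assumes [measurable]: "f \<in> borel_measurable borel" and "m \<noteq> n"
  shows "(\<integral>\<^sup>+x. f (\<chi> i. if i = m then x $ m + x $ n else x $ i) \<partial>lborel) = (\<integral>\<^sup>+x. f x \<partial>lborel)"
proof -
  interpret product_sigma_finite "\<lambda>_::'d. lborel :: real measure"
    by standard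
  define I where "I = UNIV - {m}"
  have U: "UNIV = insert m I" and I: "m \<notin> I" "n \<in> I" "finite I"
    using \<open>m \<noteq> n\<close> by (auto simp: I_def)
  let ?P = "\<lambda>J. \<Pi>\<^sub>M i\<in>J. (lborel :: real measure)"
  let ?s = "\<lambda>x::real^'d. \<chi> i. if i = m then x $ m + x $ n else x $ i"
  have *: "(\<integral>\<^sup>+x. g x \<partial>lborel) = (\<integral>\<^sup>+x. \<integral>\<^sup>+y. g (vec_lambda (x(m := y))) \<partial>lborel \<partial>?P I)"
    if g [measurable]: "g \<in> borel_measurable borel" for g :: "real^'d \<Rightarrow> ennreal"
  proof -
    have "(\<integral>\<^sup>+x. g x \<partial>lborel) = (\<integral>\<^sup>+x. g (vec_lambda x) \<partial>?P UNIV)"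
      unfolding lborel_vec_eq_PiM by (subst nn_integral_distr) auto
    also have "\<dots> = (\<integral>\<^sup>+x. g (vec_lambda x) \<partial>?P (insert m I))"
      by (simp add: U)
    also have "\<dots> = (\<integral>\<^sup>+x. \<integral>\<^sup>+y. g (vec_lambda (x(m := y))) \<partial>lborel \<partial>?P I)"
    proof (rule product_nn_integral_insert)
      have "(\<lambda>x. g (vec_lambda x)) \<in> borel_measurable (?P UNIV)"
        by measurable
      then show "(\<lambda>x. g (vec_lambda x)) \<in> borel_measurable (?P (insert m I))"
        by (simp add: U)
    qed (use I in auto)
    finally show ?thesis .
  qed
  have s [measurable]: "?s \<in> borel_measurable borel"
    by (intro borel_measurable_vec_lambda) auto
  have "(\<integral>\<^sup>+x. f (?s x) \<partial>lborel)
      = (\<integral>\<^sup>+x. \<integral>\<^sup>+y. f (?s (vec_lambda (x(m := y)))) \<partial>lborel \<partial>?P I)"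
    by (intro *) measurable
  also have "\<dots> = (\<integral>\<^sup>+x. \<integral>\<^sup>+y. f (vec_lambda (x(m := y))) \<partial>lborel \<partial>?P I)"
  proof (rule nn_integral_cong)
    fix x :: "'d \<Rightarrow> real"
    have m: "(\<lambda>y. f (vec_lambda (x(m := y)))) \<in> borel_measurable borel"
      by (intro measurable_compose[OF _ assms(1)] borel_measurable_vec_lambda) (simp add: fun_upd_def)
    have "(\<integral>\<^sup>+y. f (?s (vec_lambda (x(m := y)))) \<partial>lborel)
        = (\<integral>\<^sup>+y. f (vec_lambda (x(m := x n + y))) \<partial>lborel)"
      using \<open>m \<noteq> n\<close>
      by (intro nn_integral_cong arg_cong[where f=f]) (auto simp: vec_eq_iff)
    also have "\<dots> = (\<integral>\<^sup>+y. f (vec_lambda (x(m := y))) \<partial>(distr lborel borel ((+) (x n))))"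
      using m by (subst nn_integral_distr) simp_all
    finally show "(\<integral>\<^sup>+y. f (?s (vec_lambda (x(m := y)))) \<partial>lborel)
        = (\<integral>\<^sup>+y. f (vec_lambda (x(m := y))) \<partial>lborel)"
      by (simp add: lborel_distr_plus)
  qed
  also have "\<dots> = (\<integral>\<^sup>+x. f x \<partial>lborel)"
    by (intro *[symmetric]) measurable
  finally show ?thesis .
qed

lemma lborel_distr_transpose:
  fixes m n :: "'d::finite"
  shows "distr lborel borel (\<lambda>x::real^'d. \<chi> i. x $ Transposition.transpose m n i) = lborel"
proof (rule lborel_vec_eqI[symmetric])
  let ?\<tau> = "Transposition.transpose m n"
  have [measurable]: "(\<lambda>x::real^'d. \<chi> i. x $ ?\<tau> i) \<in> borel_measurable borel"
    by (intro borel_measurable_vec_lambda) auto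
  fix l u :: "real^'d" assume le: "\<And>i. l $ i \<le> u $ i"
  have box: "(\<lambda>x::real^'d. \<chi> i. x $ ?\<tau> i) -` {x. \<forall>i. l $ i < x $ i \<and> x $ i < u $ i}
      = {x. \<forall>i. (\<chi> j. l $ ?\<tau> j) $ i < x $ i \<and> x $ i < (\<chi> j. u $ ?\<tau> j) $ i}"
    by (auto; metis transpose_involutory)
  have "emeasure lborel {x. \<forall>i. (\<chi> j. l $ ?\<tau> j) $ i < x $ i \<and> x $ i < (\<chi> j. u $ ?\<tau> j) $ i}
      = (\<Prod>i\<in>UNIV. (\<chi> j. u $ ?\<tau> j) $ i - (\<chi> j. l $ ?\<tau> j) $ i)"
    using le by (intro emeasure_lborel_vec_box) auto
  also have "(\<Prod>i\<in>UNIV. (\<chi> j. u $ ?\<tau> j) $ i - (\<chi> j. l $ ?\<tau> j) $ i) = (\<Prod>i\<in>UNIV. u $ i - l $ i)"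
    using prod.permute[OF permutes_swap_id[of m UNIV n], of "\<lambda>i. u $ i - l $ i"]
    by (simp add: o_def)
  finally show "emeasure (distr lborel borel (\<lambda>x::real^'d. \<chi> i. x $ ?\<tau> i))
      {x. \<forall>i. l $ i < x $ i \<and> x $ i < u $ i} = (\<Prod>i\<in>UNIV. u $ i - l $ i)"
    by (subst emeasure_distr) (simp_all only: box, simp_all)
qed simp

text \<open>Invertible linear maps are compositions of diagonal maps, transpositions of coordinates and
  shears; the determinant and the scaling factor of Lebesgue measure are both multiplicative, so
  it is enough to compare them on these three kinds.\<close>

lemma nn_integral_lborel_linear:
  fixes h :: "real^'d \<Rightarrow> real^'d" and f :: "real^'d \<Rightarrow> ennreal"
  assumes "linear h" and "det (matrix h) \<noteq> 0" and "f \<in> borel_measurable borel"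
  shows "(\<integral>\<^sup>+x. f x \<partial>lborel) = ennreal \<bar>det (matrix h)\<bar> * (\<integral>\<^sup>+x. f (h x) \<partial>lborel)"
proof -
  \<comment> \<open>A singular map may occur as a factor in the induction; the guard makes its case vacuous.\<close>
  define P where "P = (\<lambda>h::real^'d \<Rightarrow> real^'d. det (matrix h) \<noteq> 0 \<longrightarrow>
     (\<forall>f \<in> borel_measurable borel.
       (\<integral>\<^sup>+x. f x \<partial>lborel) = ennreal \<bar>det (matrix h)\<bar> * (\<integral>\<^sup>+x. f (h x) \<partial>lborel)))"
  have PI: "P h" if "\<And>f. det (matrix h) \<noteq> 0 \<Longrightarrow> f \<in> borel_measurable borel \<Longrightarrow>
      (\<integral>\<^sup>+x. f x \<partial>lborel) = ennreal \<bar>det (matrix h)\<bar> * (\<integral>\<^sup>+x. f (h x) \<partial>lborel)" for h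
    using that unfolding P_def by blast
  have PD: "(\<integral>\<^sup>+x. f x \<partial>lborel) = ennreal \<bar>det (matrix h)\<bar> * (\<integral>\<^sup>+x. f (h x) \<partial>lborel)"
    if "P h" "det (matrix h) \<noteq> 0" "f \<in> borel_measurable borel" for h f
    using that unfolding P_def by blast
  have "P h"
  proof (rule induct_linear_elementary[OF assms(1)], goal_cases)
    case (1 g h)
    note [measurable] = borel_measurable_linear_vec[OF 1(1)]
    show ?case
    proof (rule PI)
      fix f :: "real^'d \<Rightarrow> ennreal"
      assume det: "det (matrix (g \<circ> h)) \<noteq> 0" and f[measurable]: "f \<in> borel_measurable borel"
      have d: "det (matrix (g \<circ> h)) = det (matrix g) * det (matrix h)"
        using 1(1,2) by (simp add: matrix_compose det_mul)
      have "(\<integral>\<^sup>+x. f x \<partial>lborel) = ennreal \<bar>det (matrix g)\<bar> * (\<integral>\<^sup>+x. f (g x) \<partial>lborel)"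
        using det d by (intro PD[OF 1(3)] f) auto
      also have "(\<integral>\<^sup>+x. f (g x) \<partial>lborel) = ennreal \<bar>det (matrix h)\<bar> * (\<integral>\<^sup>+x. f (g (h x)) \<partial>lborel)"
        using det d by (intro PD[OF 1(4)]) auto
      finally show "(\<integral>\<^sup>+x. f x \<partial>lborel) =
          ennreal \<bar>det (matrix (g \<circ> h))\<bar> * (\<integral>\<^sup>+x. f ((g \<circ> h) x) \<partial>lborel)"
        by (simp add: d abs_mult ennreal_mult mult.assoc)
    qed
  next
    case (2 h i)
    then have "row i (matrix h) = 0"
      by (auto simp: row_def matrix_def vec_eq_iff)
    then show ?case
      by (simp add: P_def det_zero_row(2))
  next
    case (3 c)
    have d: "det (matrix (\<lambda>x::real^'d. \<chi> i. c i * x $ i)) = (\<Prod>i\<in>UNIV. c i)"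
      by (subst det_diagonal) (auto simp: matrix_def axis_def)
    show ?case
    proof (rule PI, unfold d)
      fix f :: "real^'d \<Rightarrow> ennreal"
      assume nz: "(\<Prod>i\<in>UNIV. c i) \<noteq> 0" and f[measurable]: "f \<in> borel_measurable borel"
      let ?c = "\<lambda>b::real^'d. (\<chi> i. c i) \<bullet> b"
      have T: "(0::real^'d) + (\<Sum>j\<in>Basis. (?c j * (x \<bullet> j)) *\<^sub>R j) = (\<chi> i. c i * x $ i)" for x
      proof (rule euclidean_eqI)
        fix b :: "real^'d" assume b: "b \<in> Basis"
        then have "(0 + (\<Sum>j\<in>Basis. (?c j * (x \<bullet> j)) *\<^sub>R j)) \<bullet> b = ?c b * (x \<bullet> b)"
          by (simp only: add_0 inner_sum_left_Basis)
        moreover obtain i where "b = axis i 1"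
          using b by (auto simp: Basis_vec_real)
        ultimately show "(0 + (\<Sum>j\<in>Basis. (?c j * (x \<bullet> j)) *\<^sub>R j)) \<bullet> b = (\<chi> i. c i * x $ i) \<bullet> b"
          by (simp only: inner_axis) simp
      qed
      have m[measurable]: "(\<lambda>x::real^'d. \<chi> i. c i * x $ i) \<in> borel_measurable borel"
        by (intro borel_measurable_vec_lambda) auto
      have "lborel = density (distr lborel borel (\<lambda>x. (0::real^'d) + (\<Sum>j\<in>Basis. (?c j * (x \<bullet> j)) *\<^sub>R j)))
          (\<lambda>_. (\<Prod>j\<in>Basis. \<bar>?c j\<bar>))"
        using nz by (intro lborel_affine_euclidean) (auto simp: Basis_vec_real inner_axis)
      also have "(\<Prod>j\<in>Basis. \<bar>?c j\<bar>) = \<bar>\<Prod>i\<in>UNIV. c i\<bar>"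
        by (simp add: prod_Basis_vec inner_axis abs_prod)
      finally have l: "lborel = density (distr lborel borel (\<lambda>x::real^'d. \<chi> i. c i * x $ i))
          (\<lambda>_. ennreal \<bar>\<Prod>i\<in>UNIV. c i\<bar>)"
        unfolding T .
      show "(\<integral>\<^sup>+x. f x \<partial>lborel) = ennreal \<bar>\<Prod>i\<in>UNIV. c i\<bar> * (\<integral>\<^sup>+x. f (\<chi> i. c i * x $ i) \<partial>lborel)"
        by (subst l) (simp add: nn_integral_density nn_integral_distr nn_integral_cmult)
    qed
  next
    case (4 m n)
    let ?s = "\<lambda>x::real^'d. \<chi> i. x $ Transposition.transpose m n i"
    have [measurable]: "?s \<in> borel_measurable borel"
      by (intro borel_measurable_vec_lambda) auto
    have "matrix ?s = (\<chi> i. (mat 1 :: real^'d^'d) $ Transposition.transpose m n i)"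
      by (auto simp: matrix_def mat_def vec_eq_iff axis_def)
    then have d: "\<bar>det (matrix ?s)\<bar> = 1"
      by (simp add: det_permute_rows permutes_swap_id sign_swap_id abs_mult)
    show ?case
    proof (rule PI, unfold d)
      fix f :: "real^'d \<Rightarrow> ennreal" assume [measurable]: "f \<in> borel_measurable borel"
      show "(\<integral>\<^sup>+x. f x \<partial>lborel) = ennreal 1 * (\<integral>\<^sup>+x. f (?s x) \<partial>lborel)"
        by (subst lborel_distr_transpose[of m n, symmetric]) (simp add: nn_integral_distr)
    qed
  next
    case (5 m n)
    let ?s = "\<lambda>x::real^'d. \<chi> i. if i = m then x $ m + x $ n else x $ i"
    have "matrix ?s = (\<chi> k. if k = m then row m (mat 1) + 1 *s row n (mat 1) else row k (mat 1))"
      by (auto simp: matrix_def mat_def vec_eq_iff axis_def row_def)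
    then have "det (matrix ?s) = 1"
      using det_row_operation[OF 5, of "mat 1 :: real^'d^'d" 1] by simp
    then show ?case
      using 5 by (intro PI) (simp add: nn_integral_lborel_shear)
  qed
  then show ?thesis
    using assms by (intro PD)
qed

lemma lborel_eq_distr_matrix:
  fixes A :: "real^'d^'d"
  assumes "det A \<noteq> 0"
  shows "lborel = density (distr lborel borel ((*v) A)) (\<lambda>_. ennreal \<bar>det A\<bar>)"
proof (rule measure_eqI)
  fix S :: "(real^'d) set" assume "S \<in> sets lborel"
  then have [measurable]: "S \<in> sets borel" by simp
  have [measurable]: "(*v) A \<in> borel_measurable borel"
    by (intro borel_measurable_linear_vec) simp
  show "emeasure lborel S = emeasure (density (distr lborel borel ((*v) A)) (\<lambda>_. ennreal \<bar>det A\<bar>)) S"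
    using nn_integral_lborel_linear[of "(*v) A" "indicator S"] assms
    by (subst emeasure_density, simp, simp, subst nn_integral_distr) (simp_all add: nn_integral_cmult)
qed simp

lemma integrable_lborel_matrix:
  fixes A :: "real^'d^'d" and f :: "real^'d \<Rightarrow> 'b::{banach,second_countable_topology}"
  assumes "det A \<noteq> 0" and f: "integrable lborel f"
  shows "integrable lborel (\<lambda>x. f (A *v x))"
proof -
  have [measurable]: "(*v) A \<in> borel_measurable borel"
    by (intro borel_measurable_linear_vec) simp
  have [measurable]: "f \<in> borel_measurable borel"
    using f by auto
  have "integrable (density (distr lborel borel ((*v) A)) (\<lambda>_. ennreal \<bar>det A\<bar>)) f"
    using f lborel_eq_distr_matrix[OF assms(1)] by simp
  then have "integrable lborel (\<lambda>x. \<bar>det A\<bar> *\<^sub>R f (A *v x))"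
    by (simp add: integrable_density integrable_distr_eq)
  then have "integrable lborel (\<lambda>x. inverse \<bar>det A\<bar> *\<^sub>R (\<bar>det A\<bar> *\<^sub>R f (A *v x)))"
    by (rule integrable_scaleR_right)
  then show ?thesis
    using assms(1) by simp
qed

lemma integral_lborel_matrix:
  fixes A :: "real^'d^'d" and f :: "real^'d \<Rightarrow> 'b::{banach,second_countable_topology}"
  assumes "det A \<noteq> 0" and [measurable]: "f \<in> borel_measurable borel"
  shows "(\<integral>x. f x \<partial>lborel) = \<bar>det A\<bar> *\<^sub>R (\<integral>x. f (A *v x) \<partial>lborel)"
proof -
  have [measurable]: "(*v) A \<in> borel_measurable borel"
    by (intro borel_measurable_linear_vec) simp
  show ?thesis
    by (subst lborel_eq_distr_matrix[OF assms(1)])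
      (simp add: integral_density integral_distr)
qed

section \<open>Characteristic functions and Gaussian kernels\<close>

lemma integral_lborel_translate:
  fixes f :: "'a::euclidean_space \<Rightarrow> 'b::{banach,second_countable_topology}"
  assumes [measurable]: "f \<in> borel_measurable borel"
  shows "(\<integral>x. f (c + x) \<partial>lborel) = (\<integral>x. f x \<partial>lborel)"
    and "integrable lborel (\<lambda>x. f (c + x)) \<longleftrightarrow> integrable lborel f"
proof -
  have "(\<integral>x. f x \<partial>lborel) = (\<integral>x. f x \<partial>distr lborel borel ((+) c))"
    by (simp add: lborel_distr_plus)
  then show "(\<integral>x. f (c + x) \<partial>lborel) = (\<integral>x. f x \<partial>lborel)"
    by (simp add: integral_distr)
  have "integrable lborel f \<longleftrightarrow> integrable (distr lborel borel ((+) c)) f"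
    by (simp add: lborel_distr_plus)
  then show "integrable lborel (\<lambda>x. f (c + x)) \<longleftrightarrow> integrable lborel f"
    by (simp add: integrable_distr_eq)
qed

lemma integrable_mult_bounded:
  fixes f g :: "'a \<Rightarrow> complex"
  assumes f: "integrable M f" and [measurable]: "g \<in> borel_measurable M"
    and bound: "\<And>x. cmod (g x) \<le> C"
  shows "integrable M (\<lambda>x. f x * g x)"
proof (rule Bochner_Integration.integrable_bound)
  show "integrable M (\<lambda>x. C * cmod (f x))"
    using f by simp
  have C: "0 \<le> C"
    using bound order_trans[OF norm_ge_zero] by blast
  show "AE x in M. norm (f x * g x) \<le> norm (C * cmod (f x))"
    using C bound by (intro AE_I2) (auto simp: norm_mult mult.commute[of "cmod (f _)"] intro!: mult_right_mono)
qed (use f in measurable)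

text \<open>The one form in which Fubini is used below: one measure is finite and the other factor is
  integrable, so a bounded kernel is integrable on the product.\<close>

lemma Fubini_bounded_kernel:
  fixes \<eta> :: "'a::euclidean_space measure" and f :: "'b::euclidean_space \<Rightarrow> complex"
  assumes "finite_measure \<eta>" and sets [measurable_cong]: "sets \<eta> = sets borel"
    and f: "integrable lborel f"
    and k [measurable]: "(\<lambda>(x, y). k x y) \<in> borel_measurable (borel \<Otimes>\<^sub>M borel)"
    and bound: "\<And>x y. cmod (k x y) \<le> C"
  shows "(\<integral>x. (\<integral>y. f y * k x y \<partial>lborel) \<partial>\<eta>) = (\<integral>y. f y * (\<integral>x. k x y \<partial>\<eta>) \<partial>lborel)"
proof -
  interpret \<eta>: finite_measure \<eta> by fact
  interpret pair_sigma_finite \<eta> lborel ..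
  have [measurable]: "f \<in> borel_measurable borel"
    using f by auto
  have C: "0 \<le> C"
    using bound order_trans[OF norm_ge_zero] by blast
  have int: "integrable lborel (\<lambda>y. f y * k x y)" for x
    by (rule integrable_mult_bounded[OF f _ bound]) measurable
  have "integrable (\<eta> \<Otimes>\<^sub>M lborel) (\<lambda>(x, y). f y * k x y)"
  proof (rule Fubini_integrable)
    have "norm (\<integral>y. norm (case (x, y) of (x, y) \<Rightarrow> f y * k x y) \<partial>lborel) \<le> C * (\<integral>y. cmod (f y) \<partial>lborel)" for x
    proof -
      have "(\<integral>y. norm (f y * k x y) \<partial>lborel) \<le> (\<integral>y. C * cmod (f y) \<partial>lborel)"
        using f C bound
        by (intro integral_mono integrable_norm int)
          (auto simp: norm_mult mult.commute[of "cmod (f _)"] intro!: mult_right_mono)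
      then show ?thesis
        by simp
    qed
    then show "integrable \<eta> (\<lambda>x. \<integral>y. norm (case (x, y) of (x, y) \<Rightarrow> f y * k x y) \<partial>lborel)"
      by (intro \<eta>.integrable_const_bound[where B="C * (\<integral>y. cmod (f y) \<partial>lborel)"]) auto
  qed (use int in simp_all)
  from Fubini_integral[OF this] show ?thesis
    by simp
qed

lemma cmod_char_fun_le:
  assumes "finite_measure \<eta>"
  shows "cmod (char_fun \<eta> t) \<le> measure \<eta> (space \<eta>)"
proof -
  interpret finite_measure \<eta> by fact
  have "cmod (char_fun \<eta> t) \<le> (\<integral>x. cmod (iexp (t \<bullet> x)) \<partial>\<eta>)"
    unfolding char_fun_def by (rule integral_norm_bound)
  then show ?thesis by simp
qed

lemma continuous_char_fun:
  fixes \<eta> :: "(real^'d) measure"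
  assumes "finite_measure \<eta>" and sets [measurable_cong]: "sets \<eta> = sets borel"
  shows "continuous_on UNIV (char_fun \<eta>)"
proof -
  interpret finite_measure \<eta> by fact
  have "(char_fun \<eta> \<circ> u) \<longlonglongrightarrow> char_fun \<eta> t" if u: "u \<longlonglongrightarrow> t" for u t
    unfolding char_fun_def o_def
  proof (rule integral_dominated_convergence[where w="\<lambda>_. 1"])
    show "AE x in \<eta>. (\<lambda>n. iexp (u n \<bullet> x)) \<longlonglongrightarrow> iexp (t \<bullet> x)"
      by (intro AE_I2 tendsto_intros u)
  qed auto
  then show ?thesis
    by (auto simp: continuous_on_sequentially)
qed

lemma borel_measurable_char_fun:
  fixes \<eta> :: "(real^'d) measure"
  assumes "finite_measure \<eta>" "sets \<eta> = sets borel"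
  shows "char_fun \<eta> \<in> borel_measurable borel"
  using continuous_char_fun[OF assms] by (rule borel_measurable_continuous_onI)

definition gauss :: "real \<Rightarrow> real^'d \<Rightarrow> real" where
  "gauss s z = (\<Prod>i\<in>UNIV. normal_density 0 s (z $ i))"

lemma gauss_nonneg: "0 \<le> gauss s z"
  by (simp add: gauss_def prod_nonneg)

lemma gauss_diff_commute: "gauss s (x - y) = gauss s (y - x)"
  by (simp add: gauss_def normal_density_def power2_commute)

lemma gauss_le: "gauss s z \<le> normal_density 0 s 0 ^ CARD('d)" for z :: "real^'d"
proof -
  have "gauss s z \<le> (\<Prod>i\<in>(UNIV::'d set). normal_density 0 s 0)"
    unfolding gauss_def
    by (intro prod_mono conjI normal_density_nonneg) (auto simp: normal_density_def intro!: divide_right_mono)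
  then show ?thesis by simp
qed

lemma borel_measurable_gauss [measurable]: "gauss s \<in> borel_measurable borel"
  unfolding gauss_def[abs_def] by measurable

lemma
  fixes s :: real
  assumes "0 < s"
  shows integrable_gauss: "integrable lborel (gauss s :: real^'d \<Rightarrow> real)"
    and integral_gauss: "(\<integral>z. gauss s z \<partial>(lborel :: (real^'d) measure)) = 1"
  using integral_vec_prod[of "\<lambda>_::'d. normal_density 0 s"] assms
  by (simp_all add: gauss_def[abs_def])

lemma norm_vec_sq: "(norm (z :: real^'d))\<^sup>2 = (\<Sum>i\<in>UNIV. (z $ i)\<^sup>2)"
  by (simp add: norm_vec_def L2_set_def sum_nonneg)

text \<open>Through Chebyshev's inequality this bounds the mass of the kernel away from the origin.\<close>

lemma gauss_second_moment:
  fixes s :: real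
  assumes "0 < s"
  shows "integrable lborel (\<lambda>z::real^'d. gauss s z * (norm z)\<^sup>2)"
    and "(\<integral>z. gauss s z * (norm z)\<^sup>2 \<partial>(lborel :: (real^'d) measure)) = CARD('d) * s\<^sup>2"
proof -
  let ?f = "\<lambda>i j t. normal_density 0 s t * (if i = j then t\<^sup>2 else 1)"
  have int: "integrable lborel (?f i j)" for i j :: 'd
    using integrable_normal_moment[OF assms, of 0 2] assms by (cases "i = j") simp_all
  have eq: "gauss s z * (z $ i)\<^sup>2 = (\<Prod>j\<in>UNIV. ?f i j (z $ j))" for z :: "real^'d" and i
    by (simp add: gauss_def prod.distrib)
  have I: "integrable lborel (\<lambda>z::real^'d. gauss s z * (z $ i)\<^sup>2)" for i
    unfolding eq by (intro integrable_vec_prod int)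
  have "(\<integral>t. ?f i j t \<partial>lborel) = (if i = j then s\<^sup>2 else 1)" for i j :: 'd
    using integral_normal_moment_even[OF assms, of 0 1] assms
    by (cases "i = j") (simp_all add: power2_eq_square)
  then have E: "(\<integral>z. gauss s z * (z $ i)\<^sup>2 \<partial>(lborel :: (real^'d) measure)) = s\<^sup>2" for i
    unfolding eq by (subst integral_vec_prod(2)[OF int]) simp
  show "integrable lborel (\<lambda>z::real^'d. gauss s z * (norm z)\<^sup>2)"
    by (simp add: norm_vec_sq sum_distrib_left I)
  show "(\<integral>z. gauss s z * (norm z)\<^sup>2 \<partial>(lborel :: (real^'d) measure)) = CARD('d) * s\<^sup>2"
    by (simp add: norm_vec_sq sum_distrib_left I E)
qed

text \<open>The self-duality of the Gaussian, read off from the characteristic function of the standard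
  normal distribution by the substitution \<open>x = s * v\<close>. Inverting a Fourier transform is thereby
  possible for this kernel before any inversion theorem is known.\<close>

lemma normal_density_fourier:
  fixes s z :: real
  assumes "0 < s"
  shows "integrable lborel (\<lambda>v. iexp (v * z) * of_real (exp (- (s * v)\<^sup>2 / 2)))"
    and "complex_of_real (normal_density 0 s z)
      = of_real (1 / (2 * pi)) * (CLINT v|lborel. iexp (v * z) * of_real (exp (- (s * v)\<^sup>2 / 2)))"
proof -
  have sn: "exp (- x\<^sup>2 / 2) = sqrt (2 * pi) * std_normal_density x" for x :: real
    by (simp add: std_normal_density_def)
  have "integrable lborel (\<lambda>v. exp (- (s * v)\<^sup>2 / 2))"
    unfolding sn using lborel_integrable_real_affine[of std_normal_density s 0] assms by simp
  then show "integrable lborel (\<lambda>v. iexp (v * z) * of_real (exp (- (s * v)\<^sup>2 / 2)))"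
    by (rule Bochner_Integration.integrable_bound) (auto simp: norm_mult)
  have "exp (- (z / s)\<^sup>2 / 2) = char std_normal_distribution (z / s)"
    by (simp add: char_std_normal_distribution)
  also have "\<dots> = (CLINT x|lborel. std_normal_density x *\<^sub>R iexp (z / s * x))"
    unfolding char_def by (subst integral_density) auto
  also have "\<dots> = \<bar>s\<bar> *\<^sub>R (CLINT v|lborel. std_normal_density (0 + s * v) *\<^sub>R iexp (z / s * (0 + s * v)))"
    using assms by (subst lborel_integral_real_affine[where t=0 and c=s]) auto
  also have "(\<lambda>v. std_normal_density (0 + s * v) *\<^sub>R iexp (z / s * (0 + s * v)))
      = (\<lambda>v. of_real (1 / sqrt (2 * pi)) * (iexp (v * z) * of_real (exp (- (s * v)\<^sup>2 / 2))))"
    using assms by (auto simp: std_normal_density_def scaleR_conv_of_real mult_ac)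
  finally have *: "complex_of_real (exp (- (z / s)\<^sup>2 / 2))
      = s * (1 / sqrt (2 * pi)) * (CLINT v|lborel. iexp (v * z) * of_real (exp (- (s * v)\<^sup>2 / 2)))"
    using assms by (simp add: scaleR_conv_of_real)
  have "normal_density 0 s z = 1 / (s * sqrt (2 * pi)) * exp (- (z / s)\<^sup>2 / 2)"
    using assms by (simp add: normal_density_def real_sqrt_mult power_divide mult_ac)
  then have "complex_of_real (normal_density 0 s z)
    = of_real (1 / (s * sqrt (2 * pi)) * (s * (1 / sqrt (2 * pi))))
      * (CLINT v|lborel. iexp (v * z) * of_real (exp (- (s * v)\<^sup>2 / 2)))"
    by (simp only: of_real_mult * mult.assoc)
  also have "1 / (s * sqrt (2 * pi)) * (s * (1 / sqrt (2 * pi))) = 1 / (2 * pi)"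
    using assms by (simp add: field_simps)
  finally show "complex_of_real (normal_density 0 s z)
      = of_real (1 / (2 * pi)) * (CLINT v|lborel. iexp (v * z) * of_real (exp (- (s * v)\<^sup>2 / 2)))" .
qed

lemma iexp_inner: "iexp (v \<bullet> z) = (\<Prod>i\<in>UNIV. iexp (v $ i * z $ i))" for v z :: "real^'d"
  by (simp add: inner_vec_def sum_distrib_left exp_sum)

lemma exp_norm_sq: "exp (- (s * norm v)\<^sup>2 / 2) = (\<Prod>i\<in>UNIV. exp (- (s * v $ i)\<^sup>2 / 2))" for v :: "real^'d"
  by (simp add: power_mult_distrib norm_vec_sq sum_distrib_left sum_divide_distrib flip: exp_sum sum_negf)

lemma gauss_fourier:
  fixes s :: real and z :: "real^'d"
  assumes "0 < s"
  shows "integrable lborel (\<lambda>v. complex_of_real (exp (- (s * norm v)\<^sup>2 / 2)) * iexp (v \<bullet> z))"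
    and "complex_of_real (gauss s z) = of_real (1 / (2 * pi) ^ CARD('d)) *
        (CLINT v|lborel. of_real (exp (- (s * norm v)\<^sup>2 / 2)) * iexp (v \<bullet> z))"
proof -
  let ?f = "\<lambda>i v. iexp (v * z $ i) * of_real (exp (- (s * v)\<^sup>2 / 2))"
  have eq: "complex_of_real (exp (- (s * norm v)\<^sup>2 / 2)) * iexp (v \<bullet> z) = (\<Prod>i\<in>UNIV. ?f i (v $ i))"
    for v :: "real^'d"
    by (simp only: exp_norm_sq iexp_inner of_real_prod prod.distrib mult.commute)
  show "integrable lborel (\<lambda>v. complex_of_real (exp (- (s * norm v)\<^sup>2 / 2)) * iexp (v \<bullet> z))"
    unfolding eq by (intro integrable_vec_prod normal_density_fourier assms)
  show "complex_of_real (gauss s z) = of_real (1 / (2 * pi) ^ CARD('d)) *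
        (CLINT v|lborel. of_real (exp (- (s * norm v)\<^sup>2 / 2)) * iexp (v \<bullet> z))"
    unfolding eq
    by (subst integral_vec_prod(2), rule normal_density_fourier(1)[OF assms])
      (simp add: gauss_def normal_density_fourier(2)[OF assms] prod.distrib prod_dividef power_mult_distrib power_divide)
qed

section \<open>Gaussian smoothing of test functions and measures\<close>

lemma compact_support_bounded:
  fixes F :: "'a::euclidean_space \<Rightarrow> 'b::{banach,second_countable_topology}"
  assumes cont: "continuous_on UNIV F" and supp: "compact (closure {x. F x \<noteq> 0})"
  obtains B where "0 < B" "\<And>x. norm (F x) \<le> B"
proof -
  let ?K = "closure {x. F x \<noteq> 0}"
  have "compact (F ` ?K)"
    using supp cont by (intro compact_continuous_image) (auto intro: continuous_on_subset)
  then obtain B where B: "0 < B" "\<And>z. z \<in> F ` ?K \<Longrightarrow> norm z \<le> B"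
    using compact_imp_bounded bounded_pos by metis
  have "norm (F x) \<le> B" for x
  proof (cases "F x = 0")
    case False
    then have "x \<in> ?K" using closure_subset[of "{x. F x \<noteq> 0}"] by auto
    then show ?thesis using B by auto
  qed (use B in auto)
  with B that show ?thesis by blast
qed

lemma compact_support_integrable:
  fixes F :: "'a::euclidean_space \<Rightarrow> 'b::{banach,second_countable_topology}"
  assumes cont: "continuous_on UNIV F" and supp: "compact (closure {x. F x \<noteq> 0})"
  shows "integrable lborel F"
proof -
  let ?K = "closure {x. F x \<noteq> 0}"
  have "set_integrable lborel ?K F"
    using supp cont unfolding set_integrable_def
    by (intro borel_integrable_compact) (auto intro: continuous_on_subset)
  moreover have "(\<lambda>x. indicator ?K x *\<^sub>R F x) = F"
    using closure_subset[of "{x. F x \<noteq> 0}"] by (auto simp: indicator_def fun_eq_iff)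
  ultimately show ?thesis
    by (simp add: set_integrable_def)
qed

lemma compact_support_uniformly_continuous:
  fixes F :: "'a::euclidean_space \<Rightarrow> 'b::{banach,second_countable_topology}"
  assumes cont: "continuous_on UNIV F" and supp: "compact (closure {x. F x \<noteq> 0})" and "0 < e"
  obtains r where "0 < r" "\<And>x y. dist x y < r \<Longrightarrow> norm (F x - F y) \<le> e"
proof -
  obtain R where R: "\<And>x. x \<in> closure {x. F x \<noteq> 0} \<Longrightarrow> norm x \<le> R"
    using compact_imp_bounded[OF supp] bounded_iff by metis
  have 0: "F x = 0" if "R < norm x" for x
    using R[of x] that closure_subset[of "{x. F x \<noteq> 0}"] by force
  have "uniformly_continuous_on (cball 0 (R + 1)) F"
    using cont by (intro compact_uniformly_continuous) (auto intro: continuous_on_subset)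
  then obtain r where r: "0 < r" and
    rF: "\<And>x y. x \<in> cball 0 (R + 1) \<Longrightarrow> y \<in> cball 0 (R + 1) \<Longrightarrow> dist y x < r \<Longrightarrow> dist (F y) (F x) < e"
    using \<open>0 < e\<close> unfolding uniformly_continuous_on_def by metis
  show ?thesis
  proof
    show "0 < min r 1" using r by simp
    fix x y :: 'a assume d: "dist x y < min r 1"
    have n: "norm x \<le> norm y + dist x y" "norm y \<le> norm x + dist x y"
      by (auto simp: dist_norm norm_minus_commute[of x y] norm_triangle_sub)
        (metis norm_triangle_sub norm_minus_commute)
    show "norm (F x - F y) \<le> e"
    proof (cases "norm x \<le> R + 1 \<and> norm y \<le> R + 1")
      case True
      then show ?thesis
        using rF[of y x] d by (auto simp: dist_norm intro: less_imp_le)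
    next
      case False
      then have "F x = 0" "F y = 0"
        using n d by (auto intro!: 0)
      then show ?thesis
        using \<open>0 < e\<close> by simp
    qed
  qed
qed

lemma integral_gauss_diff:
  fixes s :: real and x :: "real^'d"
  assumes "0 < s"
  shows "integrable lborel (\<lambda>y. gauss s (x - y))" and "(\<integral>y. gauss s (x - y) \<partial>lborel) = 1"
    and "integrable lborel (\<lambda>y. gauss s (x - y) * (norm (x - y))\<^sup>2)"
    and "(\<integral>y. gauss s (x - y) * (norm (x - y))\<^sup>2 \<partial>lborel) = CARD('d) * s\<^sup>2"
  using integral_lborel_translate[of "gauss s :: real^'d \<Rightarrow> real" "- x"]
    integral_lborel_translate[of "\<lambda>z::real^'d. gauss s z * (norm z)\<^sup>2" "- x"]
    integrable_gauss[OF assms, where 'd='d] integral_gauss[OF assms, where 'd='d]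
    gauss_second_moment[OF assms, where 'd='d]
  by (simp_all add: gauss_diff_commute[of s x] norm_minus_commute[of x])

text \<open>Within distance \<open>r\<close> the oscillation of \<open>F\<close> is at most \<open>e\<close>; beyond it the crude bound \<open>2 * B\<close> is
  absorbed by \<open>2 * B * (norm (x - y) / r)\<^sup>2\<close>, whose Gaussian mean is known.\<close>

lemma gauss_smoothing_error:
  fixes s :: real and F :: "real^'d \<Rightarrow> complex"
  assumes [measurable]: "F \<in> borel_measurable borel" and B: "\<And>x. cmod (F x) \<le> B"
    and r: "0 < r" "\<And>x y. dist x y < r \<Longrightarrow> cmod (F x - F y) \<le> e" and e: "0 \<le> e" and s: "0 < s"
  shows "cmod ((\<integral>y. F y * of_real (gauss s (x - y)) \<partial>lborel) - F x) \<le> e + 2 * B / r\<^sup>2 * (CARD('d) * s\<^sup>2)"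
proof -
  note G = integral_gauss_diff[OF s, of x]
  have B0: "0 \<le> B" using B order_trans[OF norm_ge_zero] by blast
  have iG: "integrable lborel (\<lambda>y. complex_of_real (gauss s (x - y)))"
    using G(1) by (rule integrable_of_real)
  have iF: "integrable lborel (\<lambda>y. F y * complex_of_real (gauss s (x - y)))"
    using integrable_mult_bounded[OF iG _ B] by (simp add: mult.commute)
  have "F x = (\<integral>y. F x * of_real (gauss s (x - y)) \<partial>lborel)"
    using G(2) by (simp add: integral_complex_of_real)
  then have "(\<integral>y. F y * of_real (gauss s (x - y)) \<partial>lborel) - F x
      = (\<integral>y. F y * of_real (gauss s (x - y)) \<partial>lborel) - (\<integral>y. F x * of_real (gauss s (x - y)) \<partial>lborel)"
    by simp
  also have "\<dots> = (\<integral>y. (F y - F x) * of_real (gauss s (x - y)) \<partial>lborel)"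
    using iF iG by (subst Bochner_Integration.integral_diff[symmetric]) (auto simp: algebra_simps)
  also have "cmod \<dots> \<le> (\<integral>y. cmod ((F y - F x) * of_real (gauss s (x - y))) \<partial>lborel)"
    by (rule integral_norm_bound)
  also have "\<dots> \<le> (\<integral>y. e * gauss s (x - y) + 2 * B / r\<^sup>2 * (gauss s (x - y) * (norm (x - y))\<^sup>2) \<partial>lborel)"
  proof (rule integral_mono)
    have "integrable lborel (\<lambda>y. (F y - F x) * complex_of_real (gauss s (x - y)))"
      using iF iG by (simp add: left_diff_distrib)
    then show "integrable lborel (\<lambda>y. cmod ((F y - F x) * complex_of_real (gauss s (x - y))))"
      by (rule integrable_norm)
    show "integrable lborel (\<lambda>y. e * gauss s (x - y) + 2 * B / r\<^sup>2 * (gauss s (x - y) * (norm (x - y))\<^sup>2))"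
      using G by simp
    fix y
    have "cmod (F y - F x) \<le> e + 2 * B / r\<^sup>2 * (norm (x - y))\<^sup>2"
    proof (cases "dist y x < r")
      case True
      then show ?thesis using r(2)[of y x] B0 by (auto intro: add_increasing2)
    next
      case False
      then have "r \<le> norm (x - y)" by (simp add: dist_norm norm_minus_commute)
      then have "1 \<le> (norm (x - y) / r)\<^sup>2" using r(1) by (intro one_le_power) simp
      then have "2 * B * 1 \<le> 2 * B * (norm (x - y) / r)\<^sup>2" using B0 by (intro mult_left_mono) auto
      moreover have "cmod (F y - F x) \<le> 2 * B"
        using norm_triangle_ineq4[of "F y" "F x"] B[of x] B[of y] by simp
      ultimately show ?thesis using e by (simp add: power_divide)
    qed
    then have "cmod (F y - F x) * gauss s (x - y) \<le> (e + 2 * B / r\<^sup>2 * (norm (x - y))\<^sup>2) * gauss s (x - y)"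
      by (intro mult_right_mono gauss_nonneg)
    then show "cmod ((F y - F x) * of_real (gauss s (x - y)))
        \<le> e * gauss s (x - y) + 2 * B / r\<^sup>2 * (gauss s (x - y) * (norm (x - y))\<^sup>2)"
      by (simp only: norm_mult norm_of_real abs_of_nonneg gauss_nonneg) (simp only: algebra_simps)
  qed
  also have "\<dots> = e + 2 * B / r\<^sup>2 * (CARD('d) * s\<^sup>2)"
    using G by simp
  finally show ?thesis .
qed

lemma gauss_smoothing_uniform:
  fixes F :: "real^'d \<Rightarrow> complex"
  assumes cont: "continuous_on UNIV F" and supp: "compact (closure {x. F x \<noteq> 0})" and e: "0 < e"
  shows "\<exists>s0>0. \<forall>s. 0 < s \<and> s < s0 \<longrightarrow>
    (\<forall>x. cmod ((\<integral>y. F y * of_real (gauss s (x - y)) \<partial>lborel) - F x) \<le> e)"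
proof -
  obtain B where B: "0 < B" "\<And>x. cmod (F x) \<le> B"
    using compact_support_bounded[OF cont supp] by metis
  have "0 < e / 2" using e by simp
  then obtain r where r: "0 < r" "\<And>x y. dist x y < r \<Longrightarrow> cmod (F x - F y) \<le> e / 2"
    using compact_support_uniformly_continuous[OF cont supp] by metis
  have [measurable]: "F \<in> borel_measurable borel"
    using cont by (rule borel_measurable_continuous_onI)
  have "((\<lambda>s::real. 2 * B / r\<^sup>2 * (CARD('d) * s\<^sup>2)) \<longlongrightarrow> 2 * B / r\<^sup>2 * (CARD('d) * (0::real)\<^sup>2)) (at_right 0)"
    by (intro tendsto_intros)
  then have "eventually (\<lambda>s::real. 2 * B / r\<^sup>2 * (CARD('d) * s\<^sup>2) < e / 2) (at_right 0)"
    using e by (intro order_tendstoD(2)[where a="e / 2"]) auto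
  then obtain s0 where s0: "0 < s0" "\<And>s::real. 0 < s \<Longrightarrow> s < s0 \<Longrightarrow> 2 * B / r\<^sup>2 * (CARD('d) * s\<^sup>2) < e / 2"
    by (auto simp: eventually_at_right_field)
  have "cmod ((\<integral>y. F y * of_real (gauss s (x - y)) \<partial>lborel) - F x) \<le> e" if "0 < s" "s < s0" for s :: real and x
    using gauss_smoothing_error[OF \<open>F \<in> borel_measurable borel\<close> B(2) r, of s x] s0(2)[OF that] that e by simp
  with s0 show ?thesis by blast
qed

text \<open>This expresses the density of the smoothed measure through the characteristic function alone,
  with a Gaussian factor that makes the integral converge absolutely. Both the continuity theorem
  and the inversion theorem are limits of this identity: the first in the measure, the second as
  \<open>s\<close> tends to zero.\<close>

lemma gauss_smoothed_measure_fourier: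
  fixes \<eta> :: "(real^'d) measure"
  assumes \<eta>: "finite_measure \<eta>" "sets \<eta> = sets borel" and s: "0 < s"
  shows "complex_of_real (\<integral>x. gauss s (x - y) \<partial>\<eta>) = of_real (1 / (2 * pi) ^ CARD('d)) *
    (CLINT v|lborel. of_real (exp (- (s * norm v)\<^sup>2 / 2)) * (iexp (- (v \<bullet> y)) * char_fun \<eta> v))"
proof -
  interpret finite_measure \<eta> by fact
  note [measurable_cong] = \<eta>(2)
  have "complex_of_real (\<integral>x. gauss s (x - y) \<partial>\<eta>) = (\<integral>x. complex_of_real (gauss s (x - y)) \<partial>\<eta>)"
    by (simp add: integral_complex_of_real)
  also have "\<dots> = of_real (1 / (2 * pi) ^ CARD('d)) *
    (CLINT x|\<eta>. (CLINT v|lborel. of_real (exp (- (s * norm v)\<^sup>2 / 2)) * iexp (v \<bullet> (x - y))))"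
    by (simp only: gauss_fourier(2)[OF s] integral_mult_right_zero)
  also have "(CLINT x|\<eta>. (CLINT v|lborel. of_real (exp (- (s * norm v)\<^sup>2 / 2)) * iexp (v \<bullet> (x - y))))
    = (CLINT v|lborel. of_real (exp (- (s * norm v)\<^sup>2 / 2)) * (CLINT x|\<eta>. iexp (v \<bullet> (x - y))))"
    using gauss_fourier(1)[OF s, of "0::real^'d"]
    by (intro Fubini_bounded_kernel[OF \<eta>, where C=1]) simp_all
  also have "(\<lambda>v. CLINT x|\<eta>. iexp (v \<bullet> (x - y))) = (\<lambda>v. iexp (- (v \<bullet> y)) * char_fun \<eta> v)"
    by (simp add: char_fun_def inner_diff_right exp_diff exp_minus right_diff_distrib field_simps
        flip: integral_mult_right_zero)
  finally show ?thesis .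
qed

text \<open>Smoothing the test function or smoothing the measure gives the same integral.\<close>

lemma gauss_smoothing_adjoint:
  fixes \<eta> :: "(real^'d) measure"
  assumes \<eta>: "finite_measure \<eta>" "sets \<eta> = sets borel" and F: "integrable lborel F"
  shows "(CLINT x|\<eta>. (CLINT y|lborel. F y * of_real (gauss s (x - y))))
    = (CLINT y|lborel. F y * of_real (\<integral>x. gauss s (x - y) \<partial>\<eta>))"
  by (subst Fubini_bounded_kernel[OF \<eta> F, where C="normal_density 0 s 0 ^ CARD('d)"])
    (simp_all add: gauss_nonneg gauss_le integral_complex_of_real)

section \<open>Approximation of indicator functions\<close>

lemma open_indicator_approx:
  fixes U :: "'a::euclidean_space set"
  assumes "open U" "bounded U"
  obtains h :: "nat \<Rightarrow> 'a \<Rightarrow> real" where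
    "\<And>k. continuous_on UNIV (h k)" "\<And>k. compact (closure {x. h k x \<noteq> 0})"
    "\<And>k x. 0 \<le> h k x" "\<And>k x. h k x \<le> indicator U x"
    "\<And>x. (\<lambda>k. h k x) \<longlonglongrightarrow> indicator U x"
proof -
  define h where "h = (\<lambda>k x. min 1 (real k * infdist x (- U)))"
  have ne: "- U \<noteq> {}"
    using assms(2) not_bounded_UNIV by (metis Compl_empty_eq double_complement)
  have zero: "infdist x (- U) = 0 \<longleftrightarrow> x \<notin> U" for x
    using in_closed_iff_infdist_zero[of "- U" x] assms(1) ne by (simp add: closed_Compl)
  show ?thesis
  proof
    show "continuous_on UNIV (h k)" for k
      unfolding h_def by (intro continuous_intros)
    have "{x. h k x \<noteq> 0} \<subseteq> U" for k
      using zero by (auto simp: h_def intro: ccontr)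
    then show "compact (closure {x. h k x \<noteq> 0})" for k
      using bounded_subset[OF assms(2)] by (simp add: compact_closure)
    show "0 \<le> h k x" for k x
      by (simp add: h_def infdist_nonneg)
    show "h k x \<le> indicator U x" for k x
      using zero[of x] by (auto simp: h_def indicator_def)
    show "(\<lambda>k. h k x) \<longlonglongrightarrow> indicator U x" for x
    proof (cases "x \<in> U")
      case True
      then have p: "0 < infdist x (- U)"
        using zero[of x] infdist_nonneg[of x "- U"] by linarith
      then obtain N where N: "1 < real N * infdist x (- U)"
        using ex_less_of_nat_mult by blast
      have "h k x = 1" if "N \<le> k" for k
      proof -
        have "real N * infdist x (- U) \<le> real k * infdist x (- U)"
          using that p by (intro mult_right_mono) auto
        with N show ?thesis by (simp add: h_def)
      qed
      then have "eventually (\<lambda>k. h k x = 1) sequentially"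
        by (auto simp: eventually_sequentially)
      then show ?thesis
        using True by (simp add: tendsto_eventually)
    qed (use zero[of x] in \<open>simp add: h_def\<close>)
  qed
qed

text \<open>The bound by the integrable function \<open>h 0\<close> is part of the conclusion because it serves as the
  majorant when dominated convergence is applied to the approximants.\<close>

lemma compact_indicator_approx:
  fixes K :: "'a::euclidean_space set"
  assumes "compact K"
  obtains h :: "nat \<Rightarrow> 'a \<Rightarrow> real" where
    "\<And>k. continuous_on UNIV (h k)" "\<And>k. compact (closure {x. h k x \<noteq> 0})"
    "\<And>k x. indicator K x \<le> h k x" "\<And>x. (\<lambda>k. h k x) \<longlonglongrightarrow> indicator K x"
    "integrable lborel (h 0)" "\<And>k x. h k x \<le> h 0 x"
proof (cases "K = {}")
  case True
  show ?thesis
    by (rule that[of "\<lambda>_ _. 0"]) (simp_all add: True)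
next
  case False
  define h where "h = (\<lambda>k x. max 0 (1 - real (Suc k) * infdist x K))"
  have zero: "infdist x K = 0 \<longleftrightarrow> x \<in> K" for x
    using in_closed_iff_infdist_zero[of K x] assms False by (simp add: compact_imp_closed)
  have cont: "continuous_on UNIV (h k)" for k
    unfolding h_def by (intro continuous_intros)
  have "{x. h k x \<noteq> 0} \<subseteq> {x. infdist x K \<le> 1}" for k
  proof -
    have "h k x = 0" if "1 < infdist x K" for x
    proof -
      have "1 * 1 \<le> real (Suc k) * infdist x K"
        using that by (intro mult_mono) auto
      then show ?thesis by (simp add: h_def)
    qed
    then show ?thesis by (force simp: not_le[symmetric])
  qed
  moreover have "compact {x. infdist x K \<le> 1}"
    using compact_infdist_le[OF False assms, of 1] by simp
  ultimately have supp: "compact (closure {x. h k x \<noteq> 0})" for k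
    by (meson bounded_subset compact_closure compact_imp_bounded)
  have int: "integrable lborel (h 0)"
  proof -
    have "integrable lborel (\<lambda>x. complex_of_real (h 0 x))"
      using cont[of 0] supp[of 0] by (intro compact_support_integrable continuous_intros) auto
    then show ?thesis
      by (simp add: complex_of_real_integrable_eq)
  qed
  show ?thesis
  proof
    show "indicator K x \<le> h k x" for k x
      using zero[of x] by (auto simp: h_def indicator_def)
    show "h k x \<le> h 0 x" for k x
      unfolding h_def using mult_nonneg_nonneg[of "real k" "infdist x K"] infdist_nonneg[of x K]
      by (intro max.mono) (auto simp: algebra_simps)
    show "(\<lambda>k. h k x) \<longlonglongrightarrow> indicator K x" for x
    proof (cases "x \<in> K")
      case False
      then have p: "0 < infdist x K"
        using zero[of x] infdist_nonneg[of x K] by linarith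
      then obtain N where N: "1 < real N * infdist x K"
        using ex_less_of_nat_mult by blast
      have "h k x = 0" if "N \<le> k" for k
      proof -
        have "real N * infdist x K \<le> real (Suc k) * infdist x K"
          using that p by (intro mult_right_mono) auto
        with N show ?thesis by (simp add: h_def)
      qed
      then have "eventually (\<lambda>k. h k x = 0) sequentially"
        by (auto simp: eventually_sequentially)
      then show ?thesis
        using False by (simp add: tendsto_eventually)
    qed (use zero[of x] in \<open>simp add: h_def\<close>)
  qed (fact cont supp int)+
qed

lemma measure_eq_density_if_box:
  fixes \<eta> :: "'a::euclidean_space measure"
  assumes "finite_measure \<eta>" "sets \<eta> = sets borel"
    and [measurable]: "p \<in> borel_measurable borel"
    and box: "\<And>a b::'a. emeasure \<eta> (box a b) = (\<integral>\<^sup>+x. p x * indicator (box a b) x \<partial>lborel)"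
  shows "\<eta> = density lborel p"
proof (rule measure_eqI_generator_eq)
  interpret finite_measure \<eta> by fact
  let ?E = "range (\<lambda>(a, b). box a b::'a set)"
  show "Int_stable ?E"
    by (auto simp: Int_stable_def box_Int_box)
  show "?E \<subseteq> Pow UNIV" "sets \<eta> = sigma_sets UNIV ?E" "sets (density lborel p) = sigma_sets UNIV ?E"
    using assms(2) by (simp_all add: borel_eq_box)
  let ?A = "\<lambda>n::nat. box (- (real n *\<^sub>R One)) (real n *\<^sub>R One) :: 'a set"
  show "range ?A \<subseteq> ?E" "(\<Union>i. ?A i) = UNIV"
    unfolding UN_box_eq_UNIV by auto
  show "emeasure \<eta> (?A i) \<noteq> \<infinity>" for i
    by simp
  show "emeasure \<eta> X = emeasure (density lborel p) X" if "X \<in> ?E" for X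
    using that by (auto simp: box emeasure_density)
qed

section \<open>The continuity theorem and Fourier inversion\<close>

lemma tendsto_uniform_approx:
  fixes a :: "nat \<Rightarrow> 'a::real_normed_vector"
  assumes "\<And>e. 0 < e \<Longrightarrow> \<exists>b l'. b \<longlonglongrightarrow> l' \<and> (\<forall>n. norm (a n - b n) \<le> e) \<and> norm (l - l') \<le> e"
  shows "a \<longlonglongrightarrow> l"
proof (rule LIMSEQ_I)
  fix r :: real assume "0 < r"
  then obtain b l' where b: "b \<longlonglongrightarrow> l'" "\<And>n. norm (a n - b n) \<le> r / 4" "norm (l - l') \<le> r / 4"
    using assms[of "r / 4"] by auto
  obtain N where N: "\<And>n. N \<le> n \<Longrightarrow> norm (b n - l') < r / 4"
    using LIMSEQ_D[OF b(1), of "r / 4"] \<open>0 < r\<close> by auto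
  have "norm (a n - l) < r" if "N \<le> n" for n
  proof -
    have "a n - l = (a n - b n) + (b n - l') - (l - l')" by simp
    then have "norm (a n - l) \<le> norm (a n - b n) + norm (b n - l') + norm (l - l')"
      by (metis norm_triangle_ineq norm_triangle_ineq4 order_trans add_right_mono)
    then show ?thesis
      using b(2)[of n] b(3) N[OF that] \<open>0 < r\<close> by linarith
  qed
  then show "\<exists>N. \<forall>n\<ge>N. norm (a n - l) < r" by blast
qed

lemma gauss_smoothing_integral_error:
  fixes \<eta> :: "(real^'d) measure"
  assumes \<eta>: "finite_measure \<eta>" "sets \<eta> = sets borel"
    and F: "continuous_on UNIV F" "compact (closure {x. F x \<noteq> 0})"
    and close: "\<And>x. cmod ((CLINT y|lborel. F y * of_real (gauss s (x - y))) - F x) \<le> e"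
    and m: "measure \<eta> (space \<eta>) \<le> C" and "0 \<le> e"
  shows "cmod ((CLINT x|\<eta>. F x) - (CLINT y|lborel. F y * of_real (\<integral>x. gauss s (x - y) \<partial>\<eta>))) \<le> e * C"
proof -
  interpret finite_measure \<eta> by fact
  note [measurable_cong] = \<eta>(2)
  have Fm [measurable]: "F \<in> borel_measurable borel"
    using F by (intro borel_measurable_continuous_onI)
  obtain B where B: "\<And>x. cmod (F x) \<le> B"
    using compact_support_bounded[OF F] by metis
  let ?S = "\<lambda>x. CLINT y|lborel. F y * of_real (gauss s (x - y))"
  have iF: "integrable \<eta> F"
    using B by (intro integrable_const_bound[where B=B]) auto
  have mS: "?S \<in> borel_measurable borel"
    by measurable
  have bS: "cmod (?S x) \<le> B + e" for x
    using norm_triangle_sub[of "?S x" "F x"] close[of x] B[of x] by linarith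
  have iS: "integrable \<eta> ?S"
    using bS mS by (intro integrable_const_bound[where B="B + e"]) auto
  have "(CLINT x|\<eta>. F x) - (CLINT y|lborel. F y * of_real (\<integral>x. gauss s (x - y) \<partial>\<eta>))
      = (CLINT x|\<eta>. F x) - (CLINT x|\<eta>. ?S x)"
    using gauss_smoothing_adjoint[OF \<eta> compact_support_integrable[OF F]] by simp
  also have "\<dots> = (CLINT x|\<eta>. F x - ?S x)"
    using iF iS by simp
  also have "cmod \<dots> \<le> (\<integral>x. cmod (F x - ?S x) \<partial>\<eta>)"
    by (rule integral_norm_bound)
  also have "\<dots> \<le> (\<integral>x. e \<partial>\<eta>)"
    using iF iS close by (intro integral_mono integrable_norm) (auto simp: norm_minus_commute)
  also have "\<dots> \<le> e * C"
    using mult_left_mono[OF m \<open>0 \<le> e\<close>] by (simp add: mult.commute)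
  finally show ?thesis .
qed

lemma gauss_smoothed_measure_le:
  fixes \<eta> :: "(real^'d) measure"
  assumes \<eta>: "finite_measure \<eta>" "sets \<eta> = sets borel"
  shows "\<bar>\<integral>x. gauss s (x - y) \<partial>\<eta>\<bar> \<le> normal_density 0 s 0 ^ CARD('d) * measure \<eta> (space \<eta>)"
    and "0 \<le> (\<integral>x. gauss s (x - y) \<partial>\<eta>)"
proof -
  interpret finite_measure \<eta> by fact
  note [measurable_cong] = \<eta>(2)
  have "(\<integral>x. gauss s (x - y) \<partial>\<eta>) \<le> (\<integral>x. normal_density 0 s 0 ^ CARD('d) \<partial>\<eta>)"
    by (intro integral_mono integrable_const_bound[where B="normal_density 0 s 0 ^ CARD('d)"])
      (auto simp: gauss_nonneg gauss_le)
  moreover show "0 \<le> (\<integral>x. gauss s (x - y) \<partial>\<eta>)"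
    by (intro integral_nonneg_AE) (simp add: gauss_nonneg)
  ultimately show "\<bar>\<integral>x. gauss s (x - y) \<partial>\<eta>\<bar> \<le> normal_density 0 s 0 ^ CARD('d) * measure \<eta> (space \<eta>)"
    by (simp add: mult.commute)
qed

text \<open>After smoothing with a fixed width \<open>s\<close> the integral of \<open>F\<close> against \<open>\<nu> n\<close> converges, because the smoothed
  densities converge pointwise and boundedly. The error of smoothing is small uniformly in \<open>n\<close> since
  the total masses, being the characteristic functions at \<open>0\<close>, are bounded.\<close>

theorem char_fun_continuity_vague:
  fixes \<eta> :: "(real^'d) measure" and \<nu> :: "nat \<Rightarrow> (real^'d) measure"
  assumes \<eta>: "finite_measure \<eta>" "sets \<eta> = sets borel"
    and \<nu>: "\<And>n. finite_measure (\<nu> n)" "\<And>n. sets (\<nu> n) = sets borel"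
    and lim: "\<And>t. (\<lambda>n. char_fun (\<nu> n) t) \<longlonglongrightarrow> char_fun \<eta> t"
    and F: "continuous_on UNIV F" "compact (closure {x. F x \<noteq> 0})"
  shows "(\<lambda>n. CLINT x|\<nu> n. F x) \<longlonglongrightarrow> (CLINT x|\<eta>. F x)"
proof -
  have [measurable]: "F \<in> borel_measurable borel"
    using F by (intro borel_measurable_continuous_onI)
  have mass: "char_fun \<mu> 0 = measure \<mu> (space \<mu>)" for \<mu> :: "(real^'d) measure"
    by (simp add: char_fun_def scaleR_conv_of_real)
  have "Bseq (\<lambda>n. char_fun (\<nu> n) 0)"
    using lim[of 0] by (intro convergent_imp_Bseq convergentI)
  then obtain C where C: "0 < C" "\<And>n. measure (\<nu> n) (space (\<nu> n)) \<le> C"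
    by (auto simp: Bseq_def mass)
  define D where "D = max C (measure \<eta> (space \<eta>))"
  have D: "0 < D" "\<And>n. measure (\<nu> n) (space (\<nu> n)) \<le> D" "measure \<eta> (space \<eta>) \<le> D"
    using C by (auto simp: D_def intro: le_max_iff_disj[THEN iffD2])
  note [measurable] = borel_measurable_char_fun[OF \<eta>] borel_measurable_char_fun[OF \<nu>]
  show ?thesis
  proof (rule tendsto_uniform_approx)
    fix e :: real assume "0 < e"
    then have e: "0 < e / D" using D by simp
    obtain s0 where s0: "s0 > 0" "\<And>s x. 0 < s \<Longrightarrow> s < s0 \<Longrightarrow>
        cmod ((CLINT y|lborel. F y * of_real (gauss s (x - y))) - F x) \<le> e / D"
      using gauss_smoothing_uniform[OF F e] by blast
    define s where "s = s0 / 2"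
    have s: "0 < s" using s0 by (simp add: s_def)
    have close: "cmod ((CLINT y|lborel. F y * of_real (gauss s (x - y))) - F x) \<le> e / D" for x
      using s0 by (auto simp: s_def)
    let ?p = "\<lambda>\<mu> y. complex_of_real (\<integral>x. gauss s (x - y) \<partial>\<mu>)"
    have pw: "(\<lambda>n. ?p (\<nu> n) y) \<longlonglongrightarrow> ?p \<eta> y" for y
      unfolding gauss_smoothed_measure_fourier[OF \<nu> s] gauss_smoothed_measure_fourier[OF \<eta> s]
    proof (intro tendsto_mult_left integral_dominated_convergence[where w="\<lambda>v. D * exp (- (s * norm v)\<^sup>2 / 2)"])
      have "integrable lborel (\<lambda>v::real^'d. complex_of_real (exp (- (s * norm v)\<^sup>2 / 2)))"
        using gauss_fourier(1)[OF s, of "0::real^'d"] by simp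
      then have "integrable lborel (\<lambda>v::real^'d. exp (- (s * norm v)\<^sup>2 / 2))"
        by (simp only: complex_of_real_integrable_eq)
      then show "integrable lborel (\<lambda>v::real^'d. D * exp (- (s * norm v)\<^sup>2 / 2))"
        by simp
      show "AE v in lborel. (\<lambda>n. complex_of_real (exp (- (s * norm v)\<^sup>2 / 2)) * (iexp (- (v \<bullet> y)) * char_fun (\<nu> n) v))
          \<longlonglongrightarrow> complex_of_real (exp (- (s * norm v)\<^sup>2 / 2)) * (iexp (- (v \<bullet> y)) * char_fun \<eta> v)"
        by (intro AE_I2 tendsto_intros lim)
      show "AE v in lborel. norm (complex_of_real (exp (- (s * norm v)\<^sup>2 / 2)) * (iexp (- (v \<bullet> y)) * char_fun (\<nu> n) v))
          \<le> D * exp (- (s * norm v)\<^sup>2 / 2)" for n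
        using cmod_char_fun_le[OF \<nu>(1)[of n]] D(2)[of n]
        by (intro AE_I2) (auto simp: norm_mult mult.commute[of D] intro!: mult_left_mono intro: order_trans)
    qed measurable
    have meas: "?p \<mu> \<in> borel_measurable borel"
      if "finite_measure \<mu>" "sets \<mu> = sets borel" for \<mu> :: "(real^'d) measure"
    proof -
      interpret finite_measure \<mu> by fact
      note [measurable_cong] = that(2)
      show ?thesis by measurable
    qed
    note [measurable] = meas[OF \<eta>] meas[OF \<nu>]
    let ?G = "normal_density 0 s 0 ^ CARD('d)"
    have J: "(\<lambda>n. CLINT y|lborel. F y * ?p (\<nu> n) y) \<longlonglongrightarrow> (CLINT y|lborel. F y * ?p \<eta> y)"
    proof (intro integral_dominated_convergence[where w="\<lambda>y. cmod (F y) * (?G * D)"])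
      show "integrable lborel (\<lambda>y. cmod (F y) * (?G * D))"
        using compact_support_integrable[OF F] by simp
      show "AE y in lborel. (\<lambda>n. F y * ?p (\<nu> n) y) \<longlonglongrightarrow> F y * ?p \<eta> y"
        by (intro AE_I2 tendsto_mult_left pw)
      have "\<bar>\<integral>x. gauss s (x - y) \<partial>\<nu> n\<bar> \<le> ?G * D" for n y
        using gauss_smoothed_measure_le(1)[OF \<nu>(1)[of n] \<nu>(2)[of n], of s y]
        by (rule order_trans) (intro mult_left_mono D(2), simp)
      then show "AE y in lborel. norm (F y * ?p (\<nu> n) y) \<le> cmod (F y) * (?G * D)" for n
        by (intro AE_I2) (auto simp: norm_mult intro!: mult_left_mono)
    qed measurable
    have "cmod ((CLINT x|\<nu> n. F x) - (CLINT y|lborel. F y * ?p (\<nu> n) y)) \<le> e" for n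
      using gauss_smoothing_integral_error[OF \<nu> F close D(2)] e D by simp
    moreover have "cmod ((CLINT x|\<eta>. F x) - (CLINT y|lborel. F y * ?p \<eta> y)) \<le> e"
      using gauss_smoothing_integral_error[OF \<eta> F close D(3)] e D by simp
    ultimately show "\<exists>b l'. b \<longlonglongrightarrow> l' \<and> (\<forall>n. cmod ((CLINT x|\<nu> n. F x) - b n) \<le> e) \<and> cmod ((CLINT x|\<eta>. F x) - l') \<le> e"
      using J by blast
  qed
qed

text \<open>The Gaussian smoothings of \<open>\<eta>\<close> have nonnegative densities, which converge boundedly to \<open>p\<close>
  because the characteristic function is integrable; so \<open>p\<close> is real and nonnegative, and testing
  against continuous functions of compact support identifies \<open>\<eta>\<close> with the measure of density \<open>p\<close>.\<close>

theorem fourier_inversion: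
  fixes \<eta> :: "(real^'d) measure"
  assumes \<eta>: "finite_measure \<eta>" "sets \<eta> = sets borel" and int: "integrable lborel (char_fun \<eta>)"
  defines "p \<equiv> \<lambda>y. of_real (1 / (2 * pi) ^ CARD('d)) * (CLINT v|lborel. iexp (- (v \<bullet> y)) * char_fun \<eta> v)"
  shows "is_continuous_density \<eta> (\<lambda>y. Re (p y))" and "p y = of_real (Re (p y))"
proof -
  interpret finite_measure \<eta> by fact
  note [measurable_cong] = \<eta>(2)
  note [measurable] = borel_measurable_char_fun[OF \<eta>]
  define s where "s = (\<lambda>n. 1 / real (Suc n))"
  have s: "0 < s n" for n by (simp add: s_def)
  have s0: "s \<longlonglongrightarrow> 0" unfolding s_def using LIMSEQ_Suc[OF lim_1_over_n] by simp
  let ?q = "\<lambda>n y. (\<integral>x. gauss (s n) (x - y) \<partial>\<eta>)"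
  have q_lim: "(\<lambda>n. complex_of_real (?q n y)) \<longlonglongrightarrow> p y" for y
    unfolding gauss_smoothed_measure_fourier[OF \<eta> s] p_def
  proof (intro tendsto_mult_left integral_dominated_convergence[where w="\<lambda>v. cmod (char_fun \<eta> v)"])
    show "AE v in lborel. (\<lambda>n. complex_of_real (exp (- (s n * norm v)\<^sup>2 / 2)) * (iexp (- (v \<bullet> y)) * char_fun \<eta> v))
        \<longlonglongrightarrow> iexp (- (v \<bullet> y)) * char_fun \<eta> v"
    proof (intro AE_I2)
      fix v :: "real^'d"
      have "(\<lambda>n. complex_of_real (exp (- (s n * norm v)\<^sup>2 / 2)) * (iexp (- (v \<bullet> y)) * char_fun \<eta> v))
        \<longlonglongrightarrow> complex_of_real (exp (- (0 * norm v)\<^sup>2 / 2)) * (iexp (- (v \<bullet> y)) * char_fun \<eta> v)"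
        by (intro tendsto_intros s0) simp_all
      then show "(\<lambda>n. complex_of_real (exp (- (s n * norm v)\<^sup>2 / 2)) * (iexp (- (v \<bullet> y)) * char_fun \<eta> v))
        \<longlonglongrightarrow> iexp (- (v \<bullet> y)) * char_fun \<eta> v" by simp
    qed
    show "AE v in lborel. norm (complex_of_real (exp (- (s n * norm v)\<^sup>2 / 2)) * (iexp (- (v \<bullet> y)) * char_fun \<eta> v))
        \<le> cmod (char_fun \<eta> v)" for n
      by (intro AE_I2) (auto simp: norm_mult intro: mult_left_le_one_le)
  qed (use int in \<open>simp_all\<close>)
  have Re_lim: "(\<lambda>n. ?q n y) \<longlonglongrightarrow> Re (p y)" for y
    using tendsto_Re[OF q_lim[of y]] by simp
  have pos: "0 \<le> Re (p y)" for y
    using gauss_smoothed_measure_le(2)[OF \<eta>] by (intro LIMSEQ_le_const[OF Re_lim]) auto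
  have "(\<lambda>n. Im (complex_of_real (?q n y))) \<longlonglongrightarrow> Im (p y)" for y
    by (intro tendsto_Im q_lim)
  then have Im0: "Im (p y) = 0" for y
    by (simp add: LIMSEQ_const_iff)
  show real: "p y = of_real (Re (p y))" for y
    by (simp add: complex_eq_iff Im0)
  have cont: "continuous_on UNIV p"
  proof -
    have "(p \<circ> u) \<longlonglongrightarrow> p y" if u: "u \<longlonglongrightarrow> y" for u y
      unfolding p_def o_def
    proof (intro tendsto_mult_left integral_dominated_convergence[where w="\<lambda>v. cmod (char_fun \<eta> v)"])
      show "AE v in lborel. (\<lambda>n. iexp (- (v \<bullet> u n)) * char_fun \<eta> v) \<longlonglongrightarrow> iexp (- (v \<bullet> y)) * char_fun \<eta> v"
        by (intro AE_I2 tendsto_intros u)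
    qed (use int in \<open>auto simp: norm_mult\<close>)
    then show ?thesis
      by (auto simp: continuous_on_sequentially)
  qed
  then have contRe: "continuous_on UNIV (\<lambda>y. Re (p y))"
    by (intro continuous_intros)
  have [measurable]: "p \<in> borel_measurable borel"
    using cont by (rule borel_measurable_continuous_onI)
  \<comment> \<open>Both sides are limits of the integrals of \<open>F\<close> against the smoothed densities.\<close>
  have test: "(CLINT x|\<eta>. F x) = (CLINT y|lborel. F y * p y)"
    if F: "continuous_on UNIV F" "compact (closure {x. F x \<noteq> 0})" for F
  proof (rule LIMSEQ_unique)
    have [measurable]: "F \<in> borel_measurable borel"
      using F by (intro borel_measurable_continuous_onI)
    obtain C where C: "0 < C" "measure \<eta> (space \<eta>) \<le> C"
      by (rule that[of "measure \<eta> (space \<eta>) + 1"]) (simp_all add: add_nonneg_pos)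
    show "(\<lambda>n. CLINT y|lborel. F y * of_real (?q n y)) \<longlonglongrightarrow> (CLINT x|\<eta>. F x)"
    proof (rule LIMSEQ_I)
      fix e :: real assume "0 < e"
      then have e: "0 < e / 2 / C" using C by simp
      obtain s0 where s0: "s0 > 0" "\<And>s x. 0 < s \<Longrightarrow> s < s0 \<Longrightarrow>
          cmod ((CLINT y|lborel. F y * of_real (gauss s (x - y))) - F x) \<le> e / 2 / C"
        using gauss_smoothing_uniform[OF F e] by blast
      obtain N where N: "\<And>n. N \<le> n \<Longrightarrow> s n < s0"
        using order_tendstoD(2)[OF \<open>s \<longlonglongrightarrow> 0\<close> s0(1)] by (auto simp: eventually_sequentially)
      have "cmod ((CLINT y|lborel. F y * of_real (?q n y)) - (CLINT x|\<eta>. F x)) < e" if "N \<le> n" for n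
      proof -
        have "cmod ((CLINT x|\<eta>. F x) - (CLINT y|lborel. F y * of_real (?q n y))) \<le> e / 2 / C * C"
          using e by (intro gauss_smoothing_integral_error[OF \<eta> F] s0(2) s N that C(2)) auto
        also have "\<dots> < e" using C \<open>0 < e\<close> by simp
        finally show ?thesis by (simp only: norm_minus_commute)
      qed
      then show "\<exists>N. \<forall>n\<ge>N. cmod ((CLINT y|lborel. F y * of_real (?q n y)) - (CLINT x|\<eta>. F x)) < e"
        by blast
    qed
    let ?I = "1 / (2 * pi) ^ CARD('d) * (\<integral>v. cmod (char_fun \<eta> v) \<partial>lborel)"
    have bound: "cmod (of_real (?q n y)) \<le> ?I" for n y
    proof -
      have "cmod (CLINT v|lborel. of_real (exp (- (s n * norm v)\<^sup>2 / 2)) * (iexp (- (v \<bullet> y)) * char_fun \<eta> v))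
          \<le> (\<integral>v. cmod (char_fun \<eta> v) \<partial>lborel)"
      proof (rule order_trans[OF integral_norm_bound integral_mono_AE'])
        show "integrable lborel (\<lambda>v. cmod (char_fun \<eta> v))"
          using int by (rule integrable_norm)
      qed (auto simp: norm_mult intro!: AE_I2 mult_left_le_one_le)
      then show ?thesis
        unfolding gauss_smoothed_measure_fourier[OF \<eta> s] by (simp only: norm_mult norm_of_real) (simp add: mult_left_mono divide_right_mono)
    qed
    show "(\<lambda>n. CLINT y|lborel. F y * of_real (?q n y)) \<longlonglongrightarrow> (CLINT y|lborel. F y * p y)"
    proof (intro integral_dominated_convergence[where w="\<lambda>y. cmod (F y) * ?I"])
      show "integrable lborel (\<lambda>y. cmod (F y) * ?I)"
        using compact_support_integrable[OF F] by simp
      show "AE y in lborel. (\<lambda>n. F y * of_real (?q n y)) \<longlonglongrightarrow> F y * p y"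
        by (intro AE_I2 tendsto_mult_left q_lim)
      show "AE y in lborel. norm (F y * of_real (?q n y)) \<le> cmod (F y) * ?I" for n
        using bound by (intro AE_I2) (simp only: norm_mult, intro mult_left_mono, auto)
    qed measurable
  qed
  have "emeasure \<eta> (box a b) = (\<integral>\<^sup>+x. ennreal (Re (p x)) * indicator (box a b) x \<partial>lborel)" for a b
  proof -
    obtain h :: "nat \<Rightarrow> real^'d \<Rightarrow> real" where h:
      "\<And>k. continuous_on UNIV (h k)" "\<And>k. compact (closure {x. h k x \<noteq> 0})"
      "\<And>k x. 0 \<le> h k x" "\<And>k x. h k x \<le> indicator (box a b) x"
      "\<And>x. (\<lambda>k. h k x) \<longlonglongrightarrow> indicator (box a b) x"
      using open_indicator_approx[OF open_box bounded_box] by blast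
    have [measurable]: "h k \<in> borel_measurable borel" for k
      using h(1) by (intro borel_measurable_continuous_onI)
    have h1: "\<bar>h k x\<bar> \<le> indicator (box a b) x" for k x
      using h(3,4)[of k x] by simp
    have ib: "integrable lborel (\<lambda>x. Re (p x) * indicator (box a b) x)"
    proof -
      have "set_integrable lborel (cbox a b) (\<lambda>x. Re (p x))"
        unfolding set_integrable_def
        by (intro borel_integrable_compact compact_cbox continuous_on_subset[OF contRe]) simp
      then show ?thesis
        unfolding set_integrable_def
        by (rule Bochner_Integration.integrable_bound)
          (auto simp: indicator_def intro: box_subset_cbox[THEN subsetD])
    qed
    have eq: "(\<integral>x. h k x \<partial>\<eta>) = (\<integral>x. Re (p x) * h k x \<partial>lborel)" for k
    proof -
      have "(CLINT x|\<eta>. of_real (h k x)) = (CLINT x|lborel. of_real (h k x) * p x)"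
        using h(1,2) by (intro test continuous_intros) simp_all
      also have "\<dots> = (CLINT x|lborel. of_real (Re (p x) * h k x))"
        by (intro Bochner_Integration.integral_cong refl) (subst real, simp)
      finally show ?thesis
        by (simp only: integral_complex_of_real of_real_eq_iff)
    qed
    have "(\<lambda>k. \<integral>x. h k x \<partial>\<eta>) \<longlonglongrightarrow> (\<integral>x. indicator (box a b) x \<partial>\<eta>)"
      using h1 h(5) by (intro integral_dominated_convergence[where w="indicator (box a b)"]) (auto simp: integrable_indicator_iff less_top[symmetric])
    moreover have "(\<lambda>k. \<integral>x. Re (p x) * h k x \<partial>lborel) \<longlonglongrightarrow> (\<integral>x. Re (p x) * indicator (box a b) x \<partial>lborel)"
      using ib h1 pos
      by (intro integral_dominated_convergence[where w="\<lambda>x. Re (p x) * indicator (box a b) x"])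
        (auto simp: abs_mult intro!: tendsto_mult_left h(5) mult_left_mono)
    ultimately have "measure \<eta> (box a b) = (\<integral>x. Re (p x) * indicator (box a b) x \<partial>lborel)"
      unfolding eq using LIMSEQ_unique by fastforce
    moreover have "(\<integral>\<^sup>+x. ennreal (Re (p x)) * indicator (box a b) x \<partial>lborel)
        = (\<integral>\<^sup>+x. ennreal (Re (p x) * indicator (box a b) x) \<partial>lborel)"
      by (intro nn_integral_cong) (simp add: indicator_def)
    ultimately show ?thesis
      using ib pos by (simp add: emeasure_eq_measure nn_integral_eq_integral)
  qed
  then have "\<eta> = density lborel (\<lambda>y. ennreal (Re (p y)))"
    by (intro measure_eq_density_if_box \<eta>) auto
  with contRe pos show "is_continuous_density \<eta> (\<lambda>y. Re (p y))"
    by (simp add: is_continuous_density_def)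
qed

section \<open>Tent windows and Fejer kernels\<close>

text \<open>Normalised to integral one, so that its Fourier transform has value \<open>1\<close> at the origin for every
  width.\<close>

definition tent :: "real \<Rightarrow> real \<Rightarrow> real" where
  "tent \<delta> u = max 0 (1 - \<bar>u\<bar> / \<delta>) / \<delta>"

definition fejer :: "real \<Rightarrow> real" where
  "fejer y = (if y = 0 then 1 else 2 * (1 - cos y) / y\<^sup>2)"

lemma fejer_nonneg: "0 \<le> fejer y"
  by (simp add: fejer_def)

lemma fejer_pos: "\<bar>y\<bar> < 2 * pi \<Longrightarrow> 0 < fejer y"
proof -
  assume y: "\<bar>y\<bar> < 2 * pi"
  have "cos y \<noteq> 1" if "y \<noteq> 0"
  proof
    assume "cos y = 1"
    then obtain n :: int where n: "y = of_int n * 2 * pi"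
      by (auto simp: cos_one_2pi_int)
    then have "\<bar>of_int n :: real\<bar> < 1"
      using y by (simp add: abs_mult)
    then have "n = 0" by linarith
    with n that show False by simp
  qed
  then have "y \<noteq> 0 \<Longrightarrow> cos y < 1"
    using cos_le_one[of y] by linarith
  then show ?thesis
    by (simp add: fejer_def)
qed

lemma one_minus_cos: "1 - cos y = 2 * (sin (y / 2))\<^sup>2" for y :: real
  using cos_double_sin[of "y / 2"] by simp

lemma fejer_le_1: "fejer y \<le> 1"
proof (cases "y = 0")
  case False
  have "\<bar>sin (y / 2)\<bar> \<le> \<bar>y / 2\<bar>"
    by (rule abs_sin_x_le_abs_x)
  then have "(sin (y / 2))\<^sup>2 \<le> (y / 2)\<^sup>2"
    by (rule abs_le_square_iff[THEN iffD1])
  then show ?thesis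
    using False by (simp add: fejer_def one_minus_cos power_divide field_simps)
qed (simp add: fejer_def)

text \<open>The constant comes from adding \<open>fejer y \<le> 1\<close> and \<open>y\<^sup>2 * fejer y \<le> 4\<close>.\<close>

lemma fejer_le: "fejer y \<le> 5 * inverse (1 + y\<^sup>2)"
proof -
  have "y\<^sup>2 * fejer y \<le> 4"
  proof (cases "y = 0")
    case False
    then have "y\<^sup>2 * fejer y = 2 * (1 - cos y)" by (simp add: fejer_def)
    moreover have "2 * (1 - cos y) \<le> 4" using cos_ge_minus_one[of y] by argo
    ultimately show ?thesis by (simp only:)
  qed simp
  then have "fejer y * (1 + y\<^sup>2) \<le> 5"
    using fejer_le_1[of y] by (simp add: algebra_simps)
  moreover have "0 < 1 + y\<^sup>2"
    by (simp add: add_pos_nonneg)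
  ultimately show ?thesis
    by (simp add: field_simps)
qed

lemma borel_measurable_fejer [measurable]: "fejer \<in> borel_measurable borel"
  unfolding fejer_def[abs_def] by measurable

lemma fejer_eq_sinc: "fejer y = (sinc (y / 2))\<^sup>2"
  by (simp add: fejer_def one_minus_cos power_divide)

lemma continuous_fejer: "continuous_on UNIV fejer"
  unfolding fejer_eq_sinc[abs_def] by (intro continuous_on_power continuous_on_sinc continuous_intros) simp

lemma integrable_fejer: "integrable lborel fejer"
proof (rule Bochner_Integration.integrable_bound)
  show "integrable lborel (\<lambda>y::real. 5 * inverse (1 + y\<^sup>2))"
    using integrable_inverse_1_plus_square by (simp add: set_integrable_def einterval_def)
  show "AE y in lborel. norm (fejer y) \<le> norm (5 * inverse (1 + y\<^sup>2))"
    using fejer_le fejer_nonneg by (intro AE_I2) (auto intro: order_trans abs_ge_self)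
qed measurable

lemma tent_nonneg: "0 < \<delta> \<Longrightarrow> 0 \<le> tent \<delta> u"
  by (simp add: tent_def)

lemma tent_le: "0 < \<delta> \<Longrightarrow> tent \<delta> u \<le> 1 / \<delta>"
  by (simp add: tent_def divide_right_mono)

lemma tent_eq_0: "0 < \<delta> \<Longrightarrow> \<delta> \<le> \<bar>u\<bar> \<Longrightarrow> tent \<delta> u = 0"
  by (simp add: tent_def)

lemma borel_measurable_tent [measurable]: "tent \<delta> \<in> borel_measurable borel"
  unfolding tent_def[abs_def] by measurable

lemma integrable_tent:
  assumes "0 < \<delta>" shows "integrable lborel (tent \<delta>)"
proof -
  have "set_integrable lborel {-\<delta>..\<delta>} (tent \<delta>)"
    unfolding tent_def[abs_def] using assms
    by (intro borel_integrable_atLeastAtMost' continuous_intros) auto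
  moreover have "(\<lambda>u. indicator {-\<delta>..\<delta>} u *\<^sub>R tent \<delta> u) = tent \<delta>"
    using tent_eq_0[OF assms] by (force simp: indicator_def fun_eq_iff)
  ultimately show ?thesis
    by (simp add: set_integrable_def)
qed

text \<open>Off \<open>x = 0\<close> each half has an explicit antiderivative, with denominators powers of \<open>\<i> * x\<close>; the terms
  in \<open>\<i> / x\<close> cancel when the halves are added.\<close>

lemma integral_half_tents:
  fixes x :: real
  shows "(\<integral>u. indicator {0..1} u *\<^sub>R (of_real (1 - u) * iexp (u * x)) \<partial>lborel)
    = (if x = 0 then 1 / 2 else - iexp x / x\<^sup>2 + \<i> / x + 1 / x\<^sup>2)" (is "?I = _")
  and "(\<integral>u. indicator {-1..0} u *\<^sub>R (of_real (1 + u) * iexp (u * x)) \<partial>lborel)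
    = (if x = 0 then 1 / 2 else - iexp (- x) / x\<^sup>2 - \<i> / x + 1 / x\<^sup>2)" (is "?J = _")
proof -
  have c: "continuous_on S (\<lambda>u. of_real (1 - u) * iexp (u * x))"
    "continuous_on S (\<lambda>u. of_real (1 + u) * iexp (u * x))" for S
    by (intro continuous_intros)+
  define z where "z = \<i> * complex_of_real x"
  have z: "z = 0 \<longleftrightarrow> x = 0" "z\<^sup>2 = - (of_real x)\<^sup>2" "1 / z = - (\<i> / x)"
    by (auto simp: z_def power_mult_distrib divide_simps)
  have e: "iexp (u * x) = exp (u * z)" for u
    by (simp add: z_def mult_ac)
  show "?I = (if x = 0 then 1 / 2 else - iexp x / x\<^sup>2 + \<i> / x + 1 / x\<^sup>2)"
  proof (cases "x = 0")
    case True
    have "?I = (\<lambda>u. complex_of_real (u - u\<^sup>2 / 2)) 1 - (\<lambda>u. complex_of_real (u - u\<^sup>2 / 2)) 0"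
    proof (intro integral_FTC_atLeastAtMost c)
      fix u :: real
      have "((\<lambda>u. u - u\<^sup>2 / 2) has_real_derivative 1 - u) (at u within {0..1})"
        by (auto intro!: derivative_eq_intros)
      from has_vector_derivative_of_real[where 'a=complex, OF this]
      show "((\<lambda>u. complex_of_real (u - u\<^sup>2 / 2)) has_vector_derivative of_real (1 - u) * iexp (u * x))
          (at u within {0..1})"
        by (simp add: True)
    qed simp
    then show ?thesis by (simp add: True)
  next
    case False
    let ?G = "\<lambda>u. of_real (1 - u) * exp (of_real u * z) / z + exp (of_real u * z) / z\<^sup>2"
    have "?I = ?G 1 - ?G 0"
    proof (intro integral_FTC_atLeastAtMost c)
      fix u :: real
      show "(?G has_vector_derivative of_real (1 - u) * iexp (u * x)) (at u within {0..1})"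
        unfolding e
      proof (rule has_vector_derivative_eq_rhs)
        let ?H = "\<lambda>w::complex. (1 - w) * exp (w * z) / z + exp (w * z) / z\<^sup>2"
        have "(?H has_field_derivative (1 - u) * exp (u * z)) (at (of_real u))"
          using False z(1) by (auto intro!: derivative_eq_intros simp: field_simps power2_eq_square)
        from has_vector_derivative_real_field[OF this]
        show "(?G has_vector_derivative (1 - u) * exp (u * z)) (at u within {0..1})"
          by simp
      qed simp
    qed simp
    then show ?thesis
      using False z by (simp add: z_def)
  qed
  show "?J = (if x = 0 then 1 / 2 else - iexp (- x) / x\<^sup>2 - \<i> / x + 1 / x\<^sup>2)"
  proof (cases "x = 0")
    case True
    have "?J = (\<lambda>u. complex_of_real (u + u\<^sup>2 / 2)) 0 - (\<lambda>u. complex_of_real (u + u\<^sup>2 / 2)) (-1)"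
    proof (intro integral_FTC_atLeastAtMost c)
      fix u :: real
      have "((\<lambda>u. u + u\<^sup>2 / 2) has_real_derivative 1 + u) (at u within {-1..0})"
        by (auto intro!: derivative_eq_intros)
      from has_vector_derivative_of_real[where 'a=complex, OF this]
      show "((\<lambda>u. complex_of_real (u + u\<^sup>2 / 2)) has_vector_derivative of_real (1 + u) * iexp (u * x))
          (at u within {-1..0})"
        by (simp add: True)
    qed simp
    then show ?thesis by (simp add: True)
  next
    case False
    let ?G = "\<lambda>u. of_real (1 + u) * exp (of_real u * z) / z - exp (of_real u * z) / z\<^sup>2"
    have "?J = ?G 0 - ?G (-1)"
    proof (intro integral_FTC_atLeastAtMost c)
      fix u :: real
      show "(?G has_vector_derivative of_real (1 + u) * iexp (u * x)) (at u within {-1..0})"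
        unfolding e
      proof (rule has_vector_derivative_eq_rhs)
        let ?H = "\<lambda>w::complex. (1 + w) * exp (w * z) / z - exp (w * z) / z\<^sup>2"
        have "(?H has_field_derivative (1 + u) * exp (u * z)) (at (of_real u))"
          using False z(1) by (auto intro!: derivative_eq_intros simp: field_simps power2_eq_square)
        from has_vector_derivative_real_field[OF this]
        show "(?G has_vector_derivative (1 + u) * exp (u * z)) (at u within {-1..0})"
          by simp
      qed simp
    qed simp
    then show ?thesis
      using False z by (simp add: z_def)
  qed
qed

lemma tent_fourier:
  assumes "0 < \<delta>"
  shows "(CLINT u|lborel. of_real (tent \<delta> u) * iexp (u * x)) = of_real (fejer (\<delta> * x))"
proof -
  have unit: "(CLINT u|lborel. of_real (tent 1 u) * iexp (u * y)) = of_real (fejer y)" for y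
  proof -
    let ?f = "\<lambda>u. indicator {0..1} u *\<^sub>R (of_real (1 - u) * iexp (u * y))"
    let ?g = "\<lambda>u. indicator {-1..0} u *\<^sub>R (of_real (1 + u) * iexp (u * y))"
    have i: "integrable lborel ?f" "integrable lborel ?g"
      unfolding set_integrable_def[symmetric]
      by (intro borel_integrable_atLeastAtMost' continuous_intros)+
    \<comment> \<open>The two halves overlap in the point \<open>0\<close>.\<close>
    have "AE u in lborel. u \<noteq> (0::real)"
      by (rule AE_lborel_singleton)
    then have "AE u in lborel. of_real (tent 1 u) * iexp (u * y) = ?f u + ?g u"
      by eventually_elim (auto simp: tent_def indicator_def)
    then have "(CLINT u|lborel. of_real (tent 1 u) * iexp (u * y)) = (CLINT u|lborel. ?f u + ?g u)"
      by (intro integral_cong_AE) measurable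
    also have "\<dots> = (CLINT u|lborel. ?f u) + (CLINT u|lborel. ?g u)"
      by (intro Bochner_Integration.integral_add i)
    also have "\<dots> = of_real (fejer y)"
      unfolding integral_half_tents
      by (auto simp: fejer_def complex_eq_iff Re_exp Im_exp Re_divide_of_real Im_divide_of_real field_simps simp flip: of_real_power)
    finally show ?thesis .
  qed
  have "(CLINT u|lborel. of_real (tent \<delta> u) * iexp (u * x))
      = \<bar>\<delta>\<bar> *\<^sub>R (CLINT u|lborel. of_real (tent \<delta> (0 + \<delta> * u)) * iexp ((0 + \<delta> * u) * x))"
    using assms by (intro lborel_integral_real_affine) auto
  also have "(\<lambda>u. complex_of_real (tent \<delta> (0 + \<delta> * u)) * iexp ((0 + \<delta> * u) * x))
      = (\<lambda>u. of_real (1 / \<delta>) * (of_real (tent 1 u) * iexp (u * (\<delta> * x))))"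
    using assms by (auto simp: tent_def abs_mult mult_ac)
  also have "(CLINT u|lborel. of_real (1 / \<delta>) * (of_real (tent 1 u) * iexp (u * (\<delta> * x))))
      = of_real (1 / \<delta>) * of_real (fejer (\<delta> * x))"
    by (simp only: integral_mult_right_zero unit)
  finally show ?thesis
    using assms by (simp add: scaleR_conv_of_real)
qed

definition tent_window :: "real \<Rightarrow> real^'d \<Rightarrow> real" where
  "tent_window \<delta> u = (\<Prod>i\<in>UNIV. tent \<delta> (u $ i))"

definition fejer_kernel :: "real \<Rightarrow> real^'d \<Rightarrow> real" where
  "fejer_kernel \<delta> x = (\<Prod>i\<in>UNIV. fejer (\<delta> * x $ i))"

lemma fejer_kernel_nonneg: "0 \<le> fejer_kernel \<delta> x"
  by (simp add: fejer_kernel_def prod_nonneg fejer_nonneg)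

lemma fejer_kernel_le_1: "fejer_kernel \<delta> x \<le> 1"
  unfolding fejer_kernel_def by (intro prod_le_1) (auto simp: fejer_nonneg fejer_le_1)

lemma fejer_kernel_pos:
  assumes "0 < \<delta>" "\<delta> * norm x < 2 * pi"
  shows "0 < fejer_kernel \<delta> x"
  unfolding fejer_kernel_def
proof (intro prod_pos fejer_pos)
  fix i
  have "\<delta> * \<bar>x $ i\<bar> \<le> \<delta> * norm x"
    using assms(1) by (intro mult_left_mono component_le_norm_cart) auto
  moreover have "\<bar>\<delta> * x $ i\<bar> = \<delta> * \<bar>x $ i\<bar>"
    using assms(1) by (simp add: abs_mult)
  ultimately show "\<bar>\<delta> * x $ i\<bar> < 2 * pi"
    using assms(2) by linarith
qed

lemma continuous_fejer_kernel: "continuous_on UNIV (fejer_kernel \<delta>)"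
  unfolding fejer_kernel_def[abs_def]
  by (intro continuous_on_prod continuous_on_compose2[OF continuous_fejer] continuous_intros) auto

lemma tent_window_nonneg: "0 < \<delta> \<Longrightarrow> 0 \<le> tent_window \<delta> u"
  by (simp add: tent_window_def prod_nonneg tent_nonneg)

lemma tent_window_le: "0 < \<delta> \<Longrightarrow> tent_window \<delta> (u :: real^'d) \<le> (1 / \<delta>) ^ CARD('d)"
  using prod_mono[of "UNIV::'d set" "\<lambda>i. tent \<delta> (u $ i)" "\<lambda>_. 1 / \<delta>"]
  by (simp add: tent_window_def tent_nonneg tent_le)

lemma continuous_tent_window: "0 < \<delta> \<Longrightarrow> continuous_on UNIV (tent_window \<delta>)"
  unfolding tent_window_def[abs_def] tent_def[abs_def] by (intro continuous_intros) auto

lemma tent_window_eq_0: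
  fixes \<delta> :: real and u :: "real^'d"
  assumes "0 < \<delta>" "CARD('d) * \<delta> < norm u"
  shows "tent_window \<delta> u = 0"
proof (rule ccontr)
  assume "tent_window \<delta> u \<noteq> 0"
  then have "tent \<delta> (u $ i) \<noteq> 0" for i
    by (auto simp: tent_window_def)
  then have "\<bar>u $ i\<bar> \<le> \<delta>" for i
    using tent_eq_0[OF assms(1)] by (meson linear)
  then have "(\<Sum>i\<in>UNIV. \<bar>u $ i\<bar>) \<le> (\<Sum>i\<in>(UNIV::'d set). \<delta>)"
    by (intro sum_mono)
  with norm_le_l1_cart[of u] assms show False
    by simp
qed

lemma borel_measurable_fejer_kernel [measurable]: "fejer_kernel \<delta> \<in> borel_measurable borel"
  unfolding fejer_kernel_def[abs_def] by measurable

lemma borel_measurable_tent_window [measurable]: "tent_window \<delta> \<in> borel_measurable borel"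
  unfolding tent_window_def[abs_def] by measurable

lemma integrable_tent_window:
  assumes "0 < \<delta>" shows "integrable lborel (tent_window \<delta> :: real^'d \<Rightarrow> real)"
  unfolding tent_window_def[abs_def] by (intro integrable_vec_prod integrable_tent assms)

lemma integrable_fejer_kernel:
  assumes "0 < \<delta>" shows "integrable lborel (fejer_kernel \<delta> :: real^'d \<Rightarrow> real)"
  unfolding fejer_kernel_def[abs_def]
proof (rule integrable_vec_prod)
  show "integrable lborel (\<lambda>t. fejer (\<delta> * t))"
    using lborel_integrable_real_affine[OF integrable_fejer, of \<delta> 0] assms by simp
qed

lemma tent_window_fourier:
  assumes "0 < \<delta>"
  shows "(CLINT u|lborel. of_real (tent_window \<delta> u) * iexp (u \<bullet> x)) = of_real (fejer_kernel \<delta> x)"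
proof -
  let ?f = "\<lambda>i u. complex_of_real (tent \<delta> u) * iexp (u * x $ i)"
  have int: "integrable lborel (?f i)" for i
    using integrable_tent[OF assms]
    by (intro integrable_mult_bounded[where C=1] integrable_of_real) auto
  have "of_real (tent_window \<delta> u) * iexp (u \<bullet> x) = (\<Prod>i\<in>UNIV. ?f i (u $ i))" for u
    by (simp only: tent_window_def iexp_inner of_real_prod prod.distrib)
  then show ?thesis
    using integral_vec_prod(2)[OF int] by (simp only: tent_fourier[OF assms] fejer_kernel_def of_real_prod)
qed

text \<open>The tent window is a continuous density of the finite measure that it defines, and the
  characteristic function of that measure is the integrable Fejer kernel; the inversion theorem
  and the uniqueness of the continuous density then invert \<open>tent_window_fourier\<close>.\<close>

lemma fejer_kernel_fourier:
  fixes u :: "real^'d"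
  assumes "0 < \<delta>"
  shows "(CLINT x|lborel. of_real (fejer_kernel \<delta> x) * iexp (- (x \<bullet> u)))
    = of_real ((2 * pi) ^ CARD('d) * tent_window \<delta> u)"
proof -
  define \<tau> :: "(real^'d) measure" where "\<tau> = density lborel (\<lambda>u. ennreal (tent_window \<delta> u))"
  have \<tau>: "finite_measure \<tau>" "sets \<tau> = sets borel"
    using integrable_tent_window[OF assms, where 'd='d] tent_window_nonneg[OF assms]
    by (auto intro!: finite_measureI simp: \<tau>_def emeasure_density nn_integral_eq_integral)
  have char: "char_fun \<tau> = (\<lambda>x. of_real (fejer_kernel \<delta> x))"
  proof
    fix x
    have "char_fun \<tau> x = (CLINT u|lborel. tent_window \<delta> u *\<^sub>R iexp (x \<bullet> u))"
      unfolding char_fun_def \<tau>_def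
      by (rule integral_density) (use tent_window_nonneg[OF assms] in auto)
    then show "char_fun \<tau> x = of_real (fejer_kernel \<delta> x)"
      by (simp add: scaleR_conv_of_real inner_commute tent_window_fourier[OF assms, symmetric])
  qed
  have int: "integrable lborel (char_fun \<tau>)"
    unfolding char by (intro integrable_of_real integrable_fejer_kernel assms)
  let ?p = "\<lambda>y. of_real (1 / (2 * pi) ^ CARD('d)) * (CLINT v|lborel. iexp (- (v \<bullet> y)) * char_fun \<tau> v)"
  have "is_continuous_density \<tau> (tent_window \<delta>)"
    using continuous_tent_window[OF assms] tent_window_nonneg[OF assms]
    by (auto simp: is_continuous_density_def \<tau>_def)
  then have "tent_window \<delta> = (\<lambda>y. Re (?p y))"
    using fourier_inversion(1)[OF \<tau> int] by (rule is_continuous_density_unique)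
  then have "of_real (tent_window \<delta> u) = ?p u"
    using fourier_inversion(2)[OF \<tau> int, of u] by metis
  then show ?thesis
    by (simp add: char mult.commute field_simps)
qed

section \<open>The limit for test functions with compactly supported Fourier transform\<close>

lemma tendsto_transpose_mult_zero:
  fixes S :: "nat \<Rightarrow> real^'d^'d"
  assumes "S \<longlonglongrightarrow> 0"
  shows "(\<lambda>n. transpose (S n) *v t) \<longlonglongrightarrow> 0"
proof (rule vec_tendstoI)
  fix i
  have "(\<lambda>n. \<Sum>j\<in>UNIV. S n $ j $ i * t $ j) \<longlonglongrightarrow> (\<Sum>j\<in>UNIV. 0 $ j $ i * t $ j)"
    by (intro tendsto_sum tendsto_mult tendsto_vec_nth assms tendsto_const)
  then show "(\<lambda>n. (transpose (S n) *v t) $ i) \<longlonglongrightarrow> 0 $ i"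
    by (simp add: matrix_vector_mult_def transpose_def)
qed

lemma matrix_inv_inverse:
  fixes A :: "real^'d^'d"
  assumes "invertible A"
  shows "A ** matrix_inv A = mat 1" "matrix_inv A ** A = mat 1"
  using someI_ex[OF assms[unfolded invertible_def]] by (simp_all add: matrix_inv_def)

lemma rescaled_window_integral:
  fixes g \<phi> :: "real^'d \<Rightarrow> complex" and A :: "real^'d^'d"
  assumes A: "invertible A" and [measurable]: "g \<in> borel_measurable borel" "\<phi> \<in> borel_measurable borel"
  shows "complex_of_real \<bar>det A\<bar> * (CLINT u|lborel. g u * \<phi> u)
    = (CLINT t|lborel. g (transpose (matrix_inv A) *v t) * \<phi> (transpose (matrix_inv A) *v t))"
proof -
  have inv: "A ** matrix_inv A = mat 1"
    using A by (rule matrix_inv_inverse)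
  then have d: "det A * det (matrix_inv A) = 1"
    by (metis det_I det_mul)
  then have nz: "det (transpose (matrix_inv A)) \<noteq> 0"
    by (auto simp: det_transpose)
  have "(CLINT u|lborel. g u * \<phi> u) = of_real \<bar>det (matrix_inv A)\<bar> *
      (CLINT t|lborel. g (transpose (matrix_inv A) *v t) * \<phi> (transpose (matrix_inv A) *v t))"
    by (subst integral_lborel_matrix[OF nz]) (simp_all add: det_transpose scaleR_conv_of_real)
  then have "complex_of_real \<bar>det A\<bar> * (CLINT u|lborel. g u * \<phi> u)
    = of_real (\<bar>det A\<bar> * \<bar>det (matrix_inv A)\<bar>) *
      (CLINT t|lborel. g (transpose (matrix_inv A) *v t) * \<phi> (transpose (matrix_inv A) *v t))"
    by (simp add: mult.assoc)
  also have "\<bar>det A\<bar> * \<bar>det (matrix_inv A)\<bar> = 1"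
    using d by (simp flip: abs_mult)
  finally show ?thesis by simp
qed

lemma rescaled_window_integrable:
  fixes f :: "real^'d \<Rightarrow> complex" and A :: "real^'d^'d"
  assumes A: "invertible A" and f: "integrable lborel f"
  shows "integrable lborel (\<lambda>t. f (transpose (matrix_inv A) *v t))"
proof (rule integrable_lborel_matrix[OF _ f])
  have "invertible (matrix_inv A)"
    using matrix_inv_inverse[OF A] by (auto simp: invertible_def)
  then show "det (transpose (matrix_inv A)) \<noteq> 0"
    by (simp add: det_transpose invertible_det_nz)
qed

text \<open>Since \<open>T n *v t\<close> tends to \<open>0\<close>, the integrand converges pointwise to \<open>g 0 * \<phi> t\<close>, boundedly on balls.
  The window \<open>g\<close> vanishes outside the ball of radius \<open>k\<close>, so the part of the integral outside a large
  ball is at most \<open>B\<close> times the tail that uniform integrability at level \<open>k\<close> makes small for all \<open>n\<close>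
  at once.\<close>

lemma window_limit:
  fixes g :: "real^'d \<Rightarrow> complex" and \<phi> :: "real^'d \<Rightarrow> complex"
    and \<phi>n :: "nat \<Rightarrow> real^'d \<Rightarrow> complex" and T :: "nat \<Rightarrow> real^'d^'d"
  assumes g: "continuous_on UNIV g" "\<And>u. cmod (g u) \<le> B" "\<And>u. k < norm u \<Longrightarrow> g u = 0"
    and \<phi>: "integrable lborel \<phi>"
    and \<phi>n [measurable]: "\<And>n. \<phi>n n \<in> borel_measurable borel" and \<phi>n1: "\<And>n u. cmod (\<phi>n n u) \<le> 1"
    and int: "\<And>n. integrable lborel (\<lambda>t. g (T n *v t) * \<phi>n n (T n *v t))"
    and lim: "\<And>t. (\<lambda>n. \<phi>n n (T n *v t)) \<longlonglongrightarrow> \<phi> t"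
    and T0: "\<And>t. (\<lambda>n. T n *v t) \<longlonglongrightarrow> 0"
    and tail: "((\<lambda>a::real. SUP n. \<integral>\<^sup>+ t \<in> {t. a \<le> norm t}.
        ennreal (cmod (\<phi>n n (T n *v t)) * indicator {t. norm (T n *v t) \<le> k} t) \<partial>lborel) \<longlongrightarrow> 0) at_top"
  shows "(\<lambda>n. CLINT t|lborel. g (T n *v t) * \<phi>n n (T n *v t)) \<longlonglongrightarrow> g 0 * (CLINT t|lborel. \<phi> t)"
proof (rule tendsto_uniform_approx)
  fix e :: real assume e: "0 < e"
  have B: "0 \<le> B"
    using g(2) order_trans[OF norm_ge_zero] by blast
  have [measurable]: "g \<in> borel_measurable borel" "\<phi> \<in> borel_measurable borel"
    using g(1) \<phi> by (auto intro: borel_measurable_continuous_onI)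
  have [measurable]: "(\<lambda>t. T n *v t) \<in> borel_measurable borel" for n
    by (rule borel_measurable_linear_vec) simp
  \<comment> \<open>\<open>B\<close> may be zero, hence the shift by one.\<close>
  define e' where "e' = e / (B + 1)"
  have e': "0 < e'" "B * e' \<le> e"
    using e B by (auto simp: e'_def field_simps)
  \<comment> \<open>The radius \<open>a\<close> of the ball is chosen to make both the tails for \<open>\<phi>n\<close> and the tail of \<open>\<phi>\<close> small.\<close>
  have ev1: "eventually (\<lambda>a::real. (SUP n. \<integral>\<^sup>+ t \<in> {t. a \<le> norm t}.
        ennreal (cmod (\<phi>n n (T n *v t)) * indicator {t. norm (T n *v t) \<le> k} t) \<partial>lborel) < ennreal e') at_top"
    using e' by (intro order_tendstoD(2)[OF tail]) simp
  have "((\<lambda>a. CLINT t|lborel. indicator (ball 0 a) t *\<^sub>R \<phi> t) \<longlongrightarrow> (CLINT t|lborel. \<phi> t)) at_top"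
  proof (rule integral_dominated_convergence_at_top[where w="\<lambda>t. cmod (\<phi> t)"])
    show "AE t in lborel. ((\<lambda>a. indicator (ball 0 a) t *\<^sub>R \<phi> t) \<longlongrightarrow> \<phi> t) at_top"
    proof (intro AE_I2 tendsto_eventually)
      fix t :: "real^'d"
      show "eventually (\<lambda>a. indicator (ball 0 a) t *\<^sub>R \<phi> t = \<phi> t) at_top"
        using eventually_gt_at_top[of "norm t"] by eventually_elim simp
    qed
    show "\<forall>\<^sub>F a in at_top. AE t in lborel. norm (indicator (ball 0 a) t *\<^sub>R \<phi> t) \<le> cmod (\<phi> t)"
      by (auto simp: indicator_def)
  qed (use \<phi> in \<open>auto intro!: borel_measurable_scaleR borel_measurable_indicator\<close>)
  from tendstoD[OF this, of "e / (B + 1)"]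
  have ev2: "eventually (\<lambda>a. dist (CLINT t|lborel. indicator (ball 0 a) t *\<^sub>R \<phi> t) (CLINT t|lborel. \<phi> t) < e') at_top"
    using e'(1) by (simp add: e'_def)
  obtain a where a1: "(SUP n. \<integral>\<^sup>+ t \<in> {t. a \<le> norm t}.
        ennreal (cmod (\<phi>n n (T n *v t)) * indicator {t. norm (T n *v t) \<le> k} t) \<partial>lborel) < ennreal e'"
    and a2: "cmod ((CLINT t|lborel. indicator (ball 0 a) t *\<^sub>R \<phi> t) - (CLINT t|lborel. \<phi> t)) < e'"
    using eventually_happens[OF eventually_conj[OF ev1 ev2]] by (auto simp: dist_norm)
  let ?h = "\<lambda>n t. g (T n *v t) * \<phi>n n (T n *v t)"
  let ?b = "\<lambda>n. CLINT t|lborel. indicator (ball 0 a) t *\<^sub>R ?h n t"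
  let ?l = "CLINT t|lborel. indicator (ball 0 a) t *\<^sub>R (g 0 * \<phi> t)"
  have "?b \<longlonglongrightarrow> ?l"
  proof (rule integral_dominated_convergence[where w="\<lambda>t. B * indicator (ball 0 a) t"])
    show "integrable lborel (\<lambda>t::real^'d. B * indicator (ball 0 a) t)"
      using emeasure_bounded_finite[OF bounded_ball[of "0::real^'d" a]]
      by (auto simp: integrable_indicator_iff)
    show "AE t in lborel. (\<lambda>n. indicator (ball 0 a) t *\<^sub>R ?h n t) \<longlonglongrightarrow> indicator (ball 0 a) t *\<^sub>R (g 0 * \<phi> t)"
    proof (intro AE_I2 tendsto_scaleR tendsto_const tendsto_mult lim)
      fix t
      have "isCont g 0"
        using g(1) by (simp add: continuous_on_eq_continuous_at)
      then show "(\<lambda>n. g (T n *v t)) \<longlonglongrightarrow> g 0"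
        using T0 by (rule isCont_tendsto_compose)
    qed
    have "cmod (?h n t) \<le> B * 1" for n t
      unfolding norm_mult using B by (intro mult_mono g \<phi>n1) auto
    then show "AE t in lborel. norm (indicator (ball 0 a) t *\<^sub>R ?h n t) \<le> B * indicator (ball 0 a) t" for n
      by (auto simp: indicator_def)
  qed (auto intro!: borel_measurable_scaleR borel_measurable_indicator)
  moreover have "cmod ((CLINT t|lborel. ?h n t) - ?b n) \<le> e" for n
  proof -
    have i: "integrable lborel (\<lambda>t. indicator (ball 0 a) t *\<^sub>R ?h n t)"
      using int[of n] by (rule Bochner_Integration.integrable_bound)
        (auto simp: indicator_def intro!: borel_measurable_scaleR borel_measurable_indicator)
    have i2: "integrable lborel (\<lambda>t. ?h n t - indicator (ball 0 a) t *\<^sub>R ?h n t)"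
      using int i by simp
    have "ennreal (cmod ((CLINT t|lborel. ?h n t) - ?b n))
        = ennreal (cmod (CLINT t|lborel. ?h n t - indicator (ball 0 a) t *\<^sub>R ?h n t))"
      using int i by simp
    also have "\<dots> \<le> (\<integral>\<^sup>+t. norm (?h n t - indicator (ball 0 a) t *\<^sub>R ?h n t) \<partial>lborel)"
      by (rule integral_norm_bound_ennreal[OF i2])
    also have "\<dots> \<le> (\<integral>\<^sup>+ t. ennreal B * (ennreal (cmod (\<phi>n n (T n *v t)) * indicator {t. norm (T n *v t) \<le> k} t)
        * indicator {t. a \<le> norm t} t) \<partial>lborel)"
    proof (intro nn_integral_mono)
      fix t :: "real^'d"
      show "ennreal (norm (?h n t - indicator (ball 0 a) t *\<^sub>R ?h n t))
        \<le> ennreal B * (ennreal (cmod (\<phi>n n (T n *v t)) * indicator {t. norm (T n *v t) \<le> k} t)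
        * indicator {t. a \<le> norm t} t)"
      proof (cases "norm t < a \<or> k < norm (T n *v t)")
        case True
        then show ?thesis
          using g(3)[of "T n *v t"] by auto
      next
        case False
        then show ?thesis
          using g(2)[of "T n *v t"] B
          by (auto simp: norm_mult ennreal_mult[symmetric] intro!: ennreal_leI mult_right_mono)
      qed
    qed
    also have "\<dots> = ennreal B * (\<integral>\<^sup>+ t \<in> {t. a \<le> norm t}.
        ennreal (cmod (\<phi>n n (T n *v t)) * indicator {t. norm (T n *v t) \<le> k} t) \<partial>lborel)"
      by (intro nn_integral_cmult) measurable
    also have "\<dots> \<le> ennreal B * ennreal e'"
    proof (rule mult_left_mono)
      show "(\<integral>\<^sup>+ t \<in> {t. a \<le> norm t}.
        ennreal (cmod (\<phi>n n (T n *v t)) * indicator {t. norm (T n *v t) \<le> k} t) \<partial>lborel) \<le> ennreal e'"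
        using a1 by (intro order_trans[OF SUP_upper[of n UNIV] less_imp_le]) auto
    qed simp
    also have "\<dots> \<le> ennreal e"
      using e' B by (simp add: ennreal_mult[symmetric] ennreal_leI)
    finally show ?thesis
      using e by (simp add: ennreal_le_iff)
  qed
  moreover have "cmod (g 0 * (CLINT t|lborel. \<phi> t) - ?l) \<le> e"
  proof -
    have "?l = g 0 * (CLINT t|lborel. indicator (ball 0 a) t *\<^sub>R \<phi> t)"
      by (simp only: mult_scaleR_right[symmetric] integral_mult_right_zero)
    then have "g 0 * (CLINT t|lborel. \<phi> t) - ?l
        = g 0 * ((CLINT t|lborel. \<phi> t) - (CLINT t|lborel. indicator (ball 0 a) t *\<^sub>R \<phi> t))"
      by (simp only: right_diff_distrib)
    also have "cmod \<dots> \<le> B * e'"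
      unfolding norm_mult using a2 B g(2)[of 0] by (intro mult_mono) (auto simp: norm_minus_commute)
    finally show ?thesis using e' by simp
  qed
  ultimately show "\<exists>b l'. b \<longlonglongrightarrow> l' \<and> (\<forall>n. cmod ((CLINT t|lborel. ?h n t) - b n) \<le> e)
      \<and> cmod (g 0 * (CLINT t|lborel. \<phi> t) - l') \<le> e"
    by blast
qed

section \<open>Local limits for continuous functions and for Jordan measurable sets\<close>

lemma continuous_density_at_0:
  fixes \<mu> :: "(real^'d) measure"
  assumes "finite_measure \<mu>" "sets \<mu> = sets borel" "integrable lborel (char_fun \<mu>)"
  shows "(CLINT t|lborel. char_fun \<mu> t) = of_real ((2 * pi) ^ CARD('d) * continuous_density \<mu> 0)"
    and "0 \<le> continuous_density \<mu> 0"
proof -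
  let ?p = "\<lambda>y. of_real (1 / (2 * pi) ^ CARD('d)) * (CLINT v|lborel. iexp (- (v \<bullet> y)) * char_fun \<mu> v)"
  have eq: "continuous_density \<mu> = (\<lambda>y. Re (?p y))"
    by (rule continuous_density_eq[OF fourier_inversion(1)[OF assms]])
  have "complex_of_real (continuous_density \<mu> 0) = ?p 0"
    using fourier_inversion(2)[OF assms, of 0] unfolding eq by metis
  then show "(CLINT t|lborel. char_fun \<mu> t) = of_real ((2 * pi) ^ CARD('d) * continuous_density \<mu> 0)"
    by (simp add: field_simps)
  show "0 \<le> continuous_density \<mu> 0"
    using fourier_inversion(1)[OF assms] unfolding eq is_continuous_density_def by blast
qed

text \<open>The function \<open>fejer_kernel \<delta> x * iexp (s \<bullet> x)\<close> is the Fourier transform of the tent window translated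
  by \<open>s\<close>, which again has compact support, so \<open>window_limit\<close> applies; inversion for the Fejer kernel
  identifies the limit.\<close>

lemma fejer_kernel_char_limit:
  fixes \<mu> :: "(real^'d) measure" and \<nu> :: "nat \<Rightarrow> (real^'d) measure" and A :: "nat \<Rightarrow> real^'d^'d"
  defines "\<Sigma> \<equiv> \<lambda>n. matrix_inv (A n)"
  assumes \<mu>: "finite_measure \<mu>" "sets \<mu> = sets borel" "integrable lborel (char_fun \<mu>)"
    and \<nu>: "\<And>n. prob_space (\<nu> n)" "\<And>n. sets (\<nu> n) = sets borel"
    and A: "\<And>n. invertible (A n)" and \<Sigma>: "\<Sigma> \<longlonglongrightarrow> 0"
    and lim: "\<And>t. (\<lambda>n. char_fun (\<nu> n) (transpose (\<Sigma> n) *v t)) \<longlonglongrightarrow> char_fun \<mu> t"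
    and tail: "\<And>k::real. 0 \<le> k \<Longrightarrow>
      ((\<lambda>a::real. SUP n. \<integral>\<^sup>+ t \<in> {t. a \<le> norm t}.
          ennreal (cmod (char_fun (\<nu> n) (transpose (\<Sigma> n) *v t))
            * indicator {t. norm (transpose (\<Sigma> n) *v t) \<le> k} t) \<partial>lborel) \<longlongrightarrow> 0) at_top"
    and \<delta>: "0 < \<delta>"
  shows "(\<lambda>n. complex_of_real \<bar>det (A n)\<bar> * (CLINT x|\<nu> n. of_real (fejer_kernel \<delta> x) * iexp (s \<bullet> x)))
    \<longlonglongrightarrow> of_real (continuous_density \<mu> 0) * (CLINT x|lborel. of_real (fejer_kernel \<delta> x) * iexp (s \<bullet> x))"
proof -
  have fin: "finite_measure (\<nu> n)" for n
    using \<nu>(1)[of n] by (simp add: prob_space_def)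
  note [measurable] = borel_measurable_char_fun[OF fin \<nu>(2)]
  let ?W = "\<lambda>u::real^'d. complex_of_real (tent_window \<delta> u)"
  let ?g = "\<lambda>u. ?W (u - s)"
  have Wint: "integrable lborel ?W"
    using integrable_tent_window[OF \<delta>] by (rule integrable_of_real)
  have gint: "integrable lborel ?g"
    using integral_lborel_translate(2)[of ?W "- s"] Wint by (simp add: add.commute)
  have char_le: "cmod (char_fun (\<nu> n) u) \<le> 1" for n u
    using cmod_char_fun_le[OF fin, of n u] prob_space.prob_space[OF \<nu>(1), of n] by simp
  have window: "(CLINT x|\<nu> n. of_real (fejer_kernel \<delta> x) * iexp (s \<bullet> x)) = (CLINT u|lborel. ?g u * char_fun (\<nu> n) u)" for n
  proof -
    have "of_real (fejer_kernel \<delta> x) * iexp (s \<bullet> x) = (CLINT u|lborel. ?W u * iexp ((s + u) \<bullet> x))" for x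
    proof -
      have "of_real (fejer_kernel \<delta> x) * iexp (s \<bullet> x) = (CLINT u|lborel. ?W u * iexp (u \<bullet> x) * iexp (s \<bullet> x))"
        by (simp only: tent_window_fourier[OF \<delta>, symmetric] integral_mult_left_zero)
      then show ?thesis
        by (simp add: inner_add_left distrib_left exp_add mult_ac)
    qed
    then have "(CLINT x|\<nu> n. of_real (fejer_kernel \<delta> x) * iexp (s \<bullet> x))
        = (CLINT x|\<nu> n. CLINT u|lborel. ?W u * iexp ((s + u) \<bullet> x))"
      by simp
    also have "\<dots> = (CLINT u|lborel. ?W u * (CLINT x|\<nu> n. iexp ((s + u) \<bullet> x)))"
      by (rule Fubini_bounded_kernel[OF fin \<nu>(2) Wint, where C=1]) simp_all
    also have "\<dots> = (CLINT u|lborel. ?g (s + u) * char_fun (\<nu> n) (s + u))"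
      by (simp add: char_fun_def)
    also have "\<dots> = (CLINT u|lborel. ?g u * char_fun (\<nu> n) u)"
      by (rule integral_lborel_translate(1)) measurable
    finally show ?thesis .
  qed
  let ?k = "CARD('d) * \<delta> + norm s"
  have "(\<lambda>n. CLINT t|lborel. ?g (transpose (\<Sigma> n) *v t) * char_fun (\<nu> n) (transpose (\<Sigma> n) *v t))
      \<longlonglongrightarrow> ?g 0 * (CLINT t|lborel. char_fun \<mu> t)"
  proof (rule window_limit[where k="?k" and B="(1 / \<delta>) ^ CARD('d)"])
    have "continuous_on UNIV (\<lambda>u. tent_window \<delta> (u - s))"
      by (rule continuous_on_compose2[OF continuous_tent_window[OF \<delta>]]) (auto intro!: continuous_intros)
    then show "continuous_on UNIV ?g"
      by (intro continuous_intros)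
    show "cmod (?g u) \<le> (1 / \<delta>) ^ CARD('d)" for u
      using tent_window_le[OF \<delta>, of "u - s"] tent_window_nonneg[OF \<delta>, of "u - s"] by simp
    show "?g u = 0" if "?k < norm u" for u
    proof -
      have "CARD('d) * \<delta> < norm (u - s)"
        using that norm_triangle_sub[of u s] by linarith
      from tent_window_eq_0[OF \<delta> this] show ?thesis by simp
    qed
    show "integrable lborel (\<lambda>t. ?g (transpose (\<Sigma> n) *v t) * char_fun (\<nu> n) (transpose (\<Sigma> n) *v t))" for n
    proof -
      have "integrable lborel (\<lambda>u. ?g u * char_fun (\<nu> n) u)"
        by (rule integrable_mult_bounded[OF gint _ char_le]) measurable
      from rescaled_window_integrable[OF A this, of n] show ?thesis
        by (simp add: \<Sigma>_def)
    qed
    show "(\<lambda>n. transpose (\<Sigma> n) *v t) \<longlonglongrightarrow> 0" for t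
      by (rule tendsto_transpose_mult_zero[OF \<Sigma>])
  qed (use \<mu>(3) char_le lim tail[of ?k] \<delta> in \<open>simp_all\<close>)
  moreover have "complex_of_real \<bar>det (A n)\<bar> * (CLINT x|\<nu> n. of_real (fejer_kernel \<delta> x) * iexp (s \<bullet> x))
      = (CLINT t|lborel. ?g (transpose (\<Sigma> n) *v t) * char_fun (\<nu> n) (transpose (\<Sigma> n) *v t))" for n
    unfolding window \<Sigma>_def by (rule rescaled_window_integral[OF A]) measurable
  moreover have "?g 0 * (CLINT t|lborel. char_fun \<mu> t)
      = of_real (continuous_density \<mu> 0) * (CLINT x|lborel. of_real (fejer_kernel \<delta> x) * iexp (s \<bullet> x))"
    using fejer_kernel_fourier[OF \<delta>, of "- s"] continuous_density_at_0(1)[OF \<mu>]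
    by (simp add: inner_commute)
  ultimately show ?thesis
    by simp
qed

lemma density_char_fun:
  fixes M :: "(real^'d) measure" and w :: "real^'d \<Rightarrow> real"
  assumes M [measurable_cong]: "sets M = sets borel" and w: "integrable M w" "\<And>x. 0 \<le> w x"
  shows "finite_measure (density M (\<lambda>x. ennreal (w x)))"
    and "char_fun (density M (\<lambda>x. ennreal (w x))) t = (CLINT x|M. of_real (w x) * iexp (t \<bullet> x))"
proof -
  show "finite_measure (density M (\<lambda>x. ennreal (w x)))"
    using w by (intro finite_measureI) (simp add: emeasure_density nn_integral_eq_integral)
  show "char_fun (density M (\<lambda>x. ennreal (w x))) t = (CLINT x|M. of_real (w x) * iexp (t \<bullet> x))"
    unfolding char_fun_def using w by (subst integral_density) (auto simp: scaleR_conv_of_real)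
qed

text \<open>Weighting by the Fejer kernel turns the exploding measures \<open>\<bar>det (A n)\<bar>\<close> times \<open>\<nu> n\<close> into measures
  whose total masses converge, to which the continuity theorem applies; the weight is then divided
  out of the test function.\<close>

lemma vague_local_limit:
  fixes \<mu> :: "(real^'d) measure" and \<nu> :: "nat \<Rightarrow> (real^'d) measure" and A :: "nat \<Rightarrow> real^'d^'d"
  defines "\<Sigma> \<equiv> \<lambda>n. matrix_inv (A n)"
  assumes \<mu>: "finite_measure \<mu>" "sets \<mu> = sets borel" "integrable lborel (char_fun \<mu>)"
    and \<nu>: "\<And>n. prob_space (\<nu> n)" "\<And>n. sets (\<nu> n) = sets borel"
    and A: "\<And>n. invertible (A n)" and \<Sigma>: "\<Sigma> \<longlonglongrightarrow> 0"
    and lim: "\<And>t. (\<lambda>n. char_fun (\<nu> n) (transpose (\<Sigma> n) *v t)) \<longlonglongrightarrow> char_fun \<mu> t"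
    and tail: "\<And>k::real. 0 \<le> k \<Longrightarrow>
      ((\<lambda>a::real. SUP n. \<integral>\<^sup>+ t \<in> {t. a \<le> norm t}.
          ennreal (cmod (char_fun (\<nu> n) (transpose (\<Sigma> n) *v t))
            * indicator {t. norm (transpose (\<Sigma> n) *v t) \<le> k} t) \<partial>lborel) \<longlongrightarrow> 0) at_top"
    and f: "continuous_on UNIV f" "compact (closure {x. f x \<noteq> (0::complex)})"
  shows "(\<lambda>n. complex_of_real \<bar>det (A n)\<bar> * (CLINT x|\<nu> n. f x))
    \<longlonglongrightarrow> of_real (continuous_density \<mu> 0) * (CLINT x|lborel. f x)"
proof -
  let ?p = "continuous_density \<mu> 0"
  have p: "0 \<le> ?p"
    by (rule continuous_density_at_0(2)[OF \<mu>])
  obtain R where R: "0 < R" "\<And>x. x \<in> closure {x. f x \<noteq> 0} \<Longrightarrow> norm x \<le> R"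
    using compact_imp_bounded[OF f(2)] bounded_pos by metis
  \<comment> \<open>On the support of \<open>f\<close> the argument \<open>\<delta> * norm x\<close> is then at most \<open>1\<close>, well below the first zero \<open>2 * pi\<close>.\<close>
  define \<delta> where "\<delta> = 1 / R"
  have \<delta>: "0 < \<delta>" using R by (simp add: \<delta>_def)
  let ?H = "fejer_kernel \<delta> :: real^'d \<Rightarrow> real"
  have Hcont: "continuous_on UNIV ?H"
    by (rule continuous_fejer_kernel)
  have Hpos: "0 < ?H x" if "norm x \<le> R" for x
  proof (rule fejer_kernel_pos[OF \<delta>])
    have "\<delta> * norm x \<le> 1" using that R by (simp add: \<delta>_def)
    then show "\<delta> * norm x < 2 * pi" using pi_gt3 by linarith
  qed
  obtain x0 :: "real^'d" where x0: "norm x0 \<le> R" "\<And>x. norm x \<le> R \<Longrightarrow> ?H x0 \<le> ?H x"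
    using continuous_attains_inf[OF compact_cball, of "0::real^'d" R ?H] continuous_on_subset[OF Hcont] R
    by auto
  define c where "c = ?H x0"
  have c: "0 < c" "\<And>x. f x \<noteq> 0 \<Longrightarrow> c \<le> ?H x"
    using Hpos x0 R(2) closure_subset[of "{x. f x \<noteq> 0}"] by (auto simp: c_def)
  \<comment> \<open>The kernel has zeros away from the support of \<open>f\<close>; the maximum with its minimum \<open>c\<close> on the ball
     of radius \<open>R\<close> makes the quotient continuous everywhere and changes nothing where \<open>f\<close> is nonzero.\<close>
  define F where "F = (\<lambda>x. f x / of_real (max (?H x) c))"
  have fF: "f x = of_real (?H x) * F x" for x
    using c(1) c(2)[of x] by (cases "f x = 0") (auto simp: F_def max_def)
  have F: "continuous_on UNIV F" "compact (closure {x. F x \<noteq> 0})"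
  proof -
    show "continuous_on UNIV F"
      unfolding F_def using c(1) by (intro continuous_intros f Hcont) (auto simp: max_def)
    have "{x. F x \<noteq> 0} \<subseteq> {x. f x \<noteq> 0}" by (auto simp: F_def)
    then show "compact (closure {x. F x \<noteq> 0})"
      using f(2) by (meson bounded_closure bounded_subset closure_mono compact_closure compact_imp_bounded closure_subset)
  qed
  have [measurable]: "F \<in> borel_measurable borel"
    using F(1) by (rule borel_measurable_continuous_onI)
  define \<rho> where "\<rho> = (\<lambda>n. density (\<nu> n) (\<lambda>x. ennreal (\<bar>det (A n)\<bar> * ?H x)))"
  define \<kappa> where "\<kappa> = density lborel (\<lambda>x::real^'d. ennreal (?p * ?H x))"
  have Hint: "integrable (\<nu> n) ?H" for n
  proof -
    interpret prob_space "\<nu> n" by fact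
    note [measurable_cong] = \<nu>(2)
    show ?thesis
      by (intro integrable_const_bound[where B=1]) (simp_all add: fejer_kernel_nonneg fejer_kernel_le_1)
  qed
  have wn: "integrable (\<nu> n) (\<lambda>x. \<bar>det (A n)\<bar> * ?H x)" "0 \<le> \<bar>det (A n)\<bar> * ?H x" for n x
    using Hint by (auto simp: fejer_kernel_nonneg)
  have w: "integrable lborel (\<lambda>x. ?p * ?H x)" "0 \<le> ?p * ?H x" for x
    using integrable_fejer_kernel[OF \<delta>] p by (auto simp: fejer_kernel_nonneg)
  have "(\<lambda>n. CLINT x|\<rho> n. F x) \<longlonglongrightarrow> (CLINT x|\<kappa>. F x)"
  proof (rule char_fun_continuity_vague[OF _ _ _ _ _ F])
    show "finite_measure \<kappa>"
      unfolding \<kappa>_def by (intro density_char_fun(1) w) simp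
    show "finite_measure (\<rho> n)" for n
      unfolding \<rho>_def by (intro density_char_fun(1) \<nu> wn)
    show "sets \<kappa> = sets borel" "sets (\<rho> n) = sets borel" for n
      using \<nu>(2) by (simp_all add: \<kappa>_def \<rho>_def)
    have "char_fun (\<rho> n) s = complex_of_real \<bar>det (A n)\<bar> * (CLINT x|\<nu> n. of_real (?H x) * iexp (s \<bullet> x))" for n s
      unfolding \<rho>_def by (subst density_char_fun(2)[OF \<nu>(2) wn]) (simp add: mult.assoc)
    moreover have "char_fun \<kappa> s = of_real ?p * (CLINT x|lborel. of_real (?H x) * iexp (s \<bullet> x))" for s
      unfolding \<kappa>_def by (subst density_char_fun(2)[OF _ w]) (simp_all add: mult.assoc)
    ultimately show "(\<lambda>n. char_fun (\<rho> n) s) \<longlonglongrightarrow> char_fun \<kappa> s" for s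
      using fejer_kernel_char_limit[OF \<mu> \<nu> A \<Sigma>[unfolded \<Sigma>_def] lim[unfolded \<Sigma>_def] tail[unfolded \<Sigma>_def] \<delta>, of s]
      by simp
  qed
  moreover have "(CLINT x|\<rho> n. F x) = complex_of_real \<bar>det (A n)\<bar> * (CLINT x|\<nu> n. f x)" for n
  proof -
    note [measurable_cong] = \<nu>(2)
    have "(CLINT x|\<rho> n. F x) = (CLINT x|\<nu> n. (\<bar>det (A n)\<bar> * ?H x) *\<^sub>R F x)"
      unfolding \<rho>_def using wn by (intro integral_density) auto
    then show ?thesis
      by (simp add: fF scaleR_conv_of_real mult.assoc)
  qed
  moreover have "(CLINT x|\<kappa>. F x) = of_real ?p * (CLINT x|lborel. f x)"
  proof -
    have "(CLINT x|\<kappa>. F x) = (CLINT x|lborel. (?p * ?H x) *\<^sub>R F x)"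
      unfolding \<kappa>_def using w by (intro integral_density) auto
    then show ?thesis
      by (simp add: fF scaleR_conv_of_real mult.assoc)
  qed
  ultimately show ?thesis by simp
qed

text \<open>Continuous functions of compact support decreasing to the indicator of \<open>closure B\<close> bound the upper
  limit, and those increasing to the indicator of \<open>interior B\<close> bound the lower limit; the two bounds
  agree because the boundary is a null set.\<close>

lemma vague_limit_Jordan:
  fixes \<nu> :: "nat \<Rightarrow> 'a::euclidean_space measure" and c :: "nat \<Rightarrow> real"
  assumes \<nu>: "\<And>n. finite_measure (\<nu> n)" "\<And>n. sets (\<nu> n) = sets borel" and c: "\<And>n. 0 \<le> c n"
    and lim: "\<And>f :: 'a \<Rightarrow> complex. continuous_on UNIV f \<Longrightarrow> compact (closure {x. f x \<noteq> 0}) \<Longrightarrow>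
      (\<lambda>n. complex_of_real (c n) * (CLINT x|\<nu> n. f x)) \<longlonglongrightarrow> of_real p * (CLINT x|lborel. f x)"
    and B: "B \<in> sets borel" "compact (closure B)" "emeasure lborel (frontier B) = 0"
  shows "(\<lambda>n. c n * measure (\<nu> n) B) \<longlonglongrightarrow> p * measure lborel B"
proof -
  have real_lim: "(\<lambda>n. c n * (\<integral>x. h x \<partial>\<nu> n)) \<longlonglongrightarrow> p * (\<integral>x. h x \<partial>lborel)"
    if "continuous_on UNIV h" "compact (closure {x. h x \<noteq> 0})" for h :: "'a \<Rightarrow> real"
  proof -
    have "(\<lambda>n. complex_of_real (c n) * (CLINT x|\<nu> n. of_real (h x))) \<longlonglongrightarrow> of_real p * (CLINT x|lborel. of_real (h x))"
      using that by (intro lim continuous_intros) simp_all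
    then have "(\<lambda>n. complex_of_real (c n * (\<integral>x. h x \<partial>\<nu> n))) \<longlonglongrightarrow> of_real (p * (\<integral>x. h x \<partial>lborel))"
      by (simp add: integral_complex_of_real)
    then show ?thesis
      by (simp only: tendsto_of_real_iff)
  qed
  have fin: "emeasure lborel S < \<infinity>" if "S \<subseteq> closure B" for S
    using emeasure_mono[OF that, of lborel] emeasure_compact_finite[OF B(2)]
    by (simp add: borel_closed order_le_less_trans)
  have null: "frontier B \<in> null_sets lborel"
    using B(3) by (simp add: null_sets_def borel_closed)
  have ae: "AE x in lborel. x \<notin> frontier B"
    using null by (rule AE_not_in)
  have meas: "measure lborel (closure B) = measure lborel B" "measure lborel (interior B) = measure lborel B"
    using B(1) ae closure_subset[of B] interior_subset[of B]
    by (auto intro!: measure_eq_AE elim!: eventually_mono simp: frontier_def borel_closed borel_open)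
  show ?thesis
  proof (rule order_tendstoI)
    fix a assume a: "p * measure lborel B < a"
    obtain h :: "nat \<Rightarrow> 'a \<Rightarrow> real" where h:
      "\<And>k. continuous_on UNIV (h k)" "\<And>k. compact (closure {x. h k x \<noteq> 0})"
      "\<And>k x. indicator (closure B) x \<le> h k x" "\<And>x. (\<lambda>k. h k x) \<longlonglongrightarrow> indicator (closure B) x"
      "integrable lborel (h 0)" "\<And>k x. h k x \<le> h 0 x"
      using compact_indicator_approx[OF B(2)] by blast
    have [measurable]: "h k \<in> borel_measurable borel" for k
      using h(1) by (intro borel_measurable_continuous_onI)
    have h0: "0 \<le> h k x" for k x
      using h(3)[of x k] by (rule order_trans[rotated]) simp
    have "(\<lambda>k. p * (\<integral>x. h k x \<partial>lborel)) \<longlonglongrightarrow> p * (\<integral>x. indicator (closure B) x \<partial>lborel)"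
      using h(4-6) h0
      by (intro tendsto_mult_left integral_dominated_convergence[where w="h 0"]) (auto simp: borel_closed)
    then have "(\<lambda>k. p * (\<integral>x. h k x \<partial>lborel)) \<longlonglongrightarrow> p * measure lborel B"
      by (simp add: meas)
    from order_tendstoD(2)[OF this a] obtain k where "p * (\<integral>x. h k x \<partial>lborel) < a"
      using eventually_happens sequentially_bot by blast
    with real_lim[OF h(1,2)] have "eventually (\<lambda>n. c n * (\<integral>x. h k x \<partial>\<nu> n) < a) sequentially"
      by (rule order_tendstoD(2))
    moreover have "c n * measure (\<nu> n) B \<le> c n * (\<integral>x. h k x \<partial>\<nu> n)" for n
    proof (intro mult_left_mono c)
      interpret finite_measure "\<nu> n" by fact
      note [measurable_cong] = \<nu>(2)
      obtain C where C: "\<And>x. cmod (of_real (h k x)) \<le> C"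
        using compact_support_bounded[of "\<lambda>x. complex_of_real (h k x)"] h(1,2)[of k]
        by (auto intro: continuous_on_of_real)
      have "measure (\<nu> n) B = (\<integral>x. indicator B x \<partial>\<nu> n)"
        using B(1) \<nu>(2)[of n] by (simp add: sets_eq_imp_space_eq[OF \<nu>(2)])
      also have "\<dots> \<le> (\<integral>x. h k x \<partial>\<nu> n)"
      proof (rule integral_mono)
        show "integrable (\<nu> n) (\<lambda>x. indicator B x :: real)"
          using B(1) \<nu>(2)[of n] by (simp add: integrable_indicator_iff less_top[symmetric])
        show "integrable (\<nu> n) (h k)"
          using C by (intro integrable_const_bound[where B=C]) auto
        show "indicator B x \<le> h k x" for x
          using h(3)[of x k] closure_subset[of B]
          by (intro order_trans[OF _ h(3)]) (auto simp: indicator_def)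
      qed
      finally show "measure (\<nu> n) B \<le> (\<integral>x. h k x \<partial>\<nu> n)" .
    qed
    ultimately show "eventually (\<lambda>n. c n * measure (\<nu> n) B < a) sequentially"
      by (auto elim!: eventually_mono intro: order_le_less_trans)
  next
    fix a assume a: "a < p * measure lborel B"
    have bd: "bounded (interior B)"
      using compact_imp_bounded[OF B(2)] bounded_subset closure_subset interior_subset by (metis order_trans)
    obtain h :: "nat \<Rightarrow> 'a \<Rightarrow> real" where h:
      "\<And>k. continuous_on UNIV (h k)" "\<And>k. compact (closure {x. h k x \<noteq> 0})"
      "\<And>k x. 0 \<le> h k x" "\<And>k x. h k x \<le> indicator (interior B) x"
      "\<And>x. (\<lambda>k. h k x) \<longlonglongrightarrow> indicator (interior B) x"
      using open_indicator_approx[OF open_interior bd] by blast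
    have [measurable]: "h k \<in> borel_measurable borel" for k
      using h(1) by (intro borel_measurable_continuous_onI)
    have "interior B \<subseteq> closure B"
      using closure_subset interior_subset by (metis order_trans)
    from fin[OF this] have iint: "integrable lborel (indicator (interior B) :: 'a \<Rightarrow> real)"
      by (simp add: integrable_indicator_iff borel_open)
    have "(\<lambda>k. p * (\<integral>x. h k x \<partial>lborel)) \<longlonglongrightarrow> p * (\<integral>x. indicator (interior B) x \<partial>lborel)"
      using h(3-5) iint
      by (intro tendsto_mult_left integral_dominated_convergence[where w="indicator (interior B)"])
        (auto simp: borel_open)
    then have "(\<lambda>k. p * (\<integral>x. h k x \<partial>lborel)) \<longlonglongrightarrow> p * measure lborel B"
      by (simp add: meas)
    from order_tendstoD(1)[OF this a] obtain k where "a < p * (\<integral>x. h k x \<partial>lborel)"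
      using eventually_happens sequentially_bot by blast
    with real_lim[OF h(1,2)] have "eventually (\<lambda>n. a < c n * (\<integral>x. h k x \<partial>\<nu> n)) sequentially"
      by (rule order_tendstoD(1))
    moreover have "c n * (\<integral>x. h k x \<partial>\<nu> n) \<le> c n * measure (\<nu> n) B" for n
    proof (intro mult_left_mono c)
      interpret finite_measure "\<nu> n" by fact
      note [measurable_cong] = \<nu>(2)
      have hB: "h k x \<le> indicator B x" for x
        using h(4)[of k x] interior_subset[of B]
        by (elim order_trans) (auto simp: indicator_def)
      have hB1: "\<bar>h k x\<bar> \<le> 1" for x
        using h(3)[of k x] order_trans[OF hB indicator_le_1, of x] by simp
      have "(\<integral>x. h k x \<partial>\<nu> n) \<le> (\<integral>x. indicator B x \<partial>\<nu> n)"
      proof (rule integral_mono)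
        show "integrable (\<nu> n) (\<lambda>x. indicator B x :: real)"
          using B(1) \<nu>(2)[of n] by (simp add: integrable_indicator_iff less_top[symmetric])
        show "integrable (\<nu> n) (h k)"
          using hB1 by (intro integrable_const_bound[where B=1]) auto
      qed (rule hB)
      also have "\<dots> = measure (\<nu> n) B"
        using B(1) \<nu>(2)[of n] by (simp add: sets_eq_imp_space_eq[OF \<nu>(2)])
      finally show "(\<integral>x. h k x \<partial>\<nu> n) \<le> measure (\<nu> n) B" .
    qed
    ultimately show "eventually (\<lambda>n. a < c n * measure (\<nu> n) B) sequentially"
      by (auto elim!: eventually_mono intro: order_less_le_trans)
  qed
qed

theorem theorem4:
  fixes \<mu> :: "(real ^ 'd) measure"
    and M :: "nat \<Rightarrow> 'a measure"
    and X :: "nat \<Rightarrow> 'a \<Rightarrow> real ^ 'd"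
    and A :: "nat \<Rightarrow> real ^ 'd ^ 'd"
  assumes "prob_space \<mu>" and "sets \<mu> = sets borel"
    and "\<And>n. prob_space (M n)"
    and "\<And>n. X n \<in> borel_measurable (M n)"
    and "mod_phi_convergence \<mu> M X A"
  shows "(\<forall>f :: real ^ 'd \<Rightarrow> complex.
            continuous_on UNIV f \<longrightarrow> compact (closure {x. f x \<noteq> 0}) \<longrightarrow>
            (\<lambda>n. complex_of_real \<bar>det (A n)\<bar> * (CLINT \<omega>|M n. f (X n \<omega>)))
              \<longlonglongrightarrow> complex_of_real (continuous_density \<mu> 0) * (CLINT x|lborel. f x)) \<and>
         (\<forall>B \<in> sets (borel :: (real ^ 'd) measure).
            compact (closure B) \<longrightarrow> emeasure lborel (frontier B) = 0 \<longrightarrow>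
            (\<lambda>n. \<bar>det (A n)\<bar> * measure (M n) {\<omega> \<in> space (M n). X n \<omega> \<in> B})
              \<longlonglongrightarrow> continuous_density \<mu> 0 * measure lborel B)"
proof -
  define \<nu> where "\<nu> = (\<lambda>n. distr (M n) borel (X n))"
  have \<mu>: "finite_measure \<mu>" "sets \<mu> = sets borel" "integrable lborel (char_fun \<mu>)"
    using assms by (simp_all add: mod_phi_convergence_def prob_space_def Let_def)
  have \<nu>: "prob_space (\<nu> n)" "sets (\<nu> n) = sets borel" for n
    using prob_space.prob_space_distr[OF assms(3) assms(4)] by (simp_all add: \<nu>_def)
  have uniform: "uniform_limit {t} (\<lambda>n t. char_fun (\<nu> n) (transpose (matrix_inv (A n)) *v t)) (char_fun \<mu>) sequentially" for t
    using assms(5) by (simp add: mod_phi_convergence_def Let_def \<nu>_def del: uniform_limit_singleton)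
  have lim: "(\<lambda>n. char_fun (\<nu> n) (transpose (matrix_inv (A n)) *v t)) \<longlonglongrightarrow> char_fun \<mu> t" for t
    using tendsto_uniform_limitI[OF uniform[of t]] by simp
  have vague: "(\<lambda>n. complex_of_real \<bar>det (A n)\<bar> * (CLINT x|\<nu> n. f x))
      \<longlonglongrightarrow> of_real (continuous_density \<mu> 0) * (CLINT x|lborel. f x)"
    if "continuous_on UNIV f" "compact (closure {x. f x \<noteq> 0})" for f
    using assms(5) that
    by (intro vague_local_limit[OF \<mu> \<nu> _ _ lim]) (simp_all add: mod_phi_convergence_def Let_def \<nu>_def)
  have law: "(CLINT x|\<nu> n. f x) = (CLINT \<omega>|M n. f (X n \<omega>))" if "continuous_on UNIV f" for f :: "real^'d \<Rightarrow> complex" and n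
    unfolding \<nu>_def using assms(4)[of n] borel_measurable_continuous_onI[OF that] by (rule integral_distr)
  have prob: "measure (\<nu> n) B = measure (M n) {\<omega> \<in> space (M n). X n \<omega> \<in> B}" if "B \<in> sets borel" for n B
    unfolding \<nu>_def using assms(4)[of n] that by (subst measure_distr) (auto intro!: arg_cong2[where f=measure])
  have "(\<lambda>n. \<bar>det (A n)\<bar> * measure (\<nu> n) B) \<longlonglongrightarrow> continuous_density \<mu> 0 * measure lborel B"
    if "B \<in> sets borel" "compact (closure B)" "emeasure lborel (frontier B) = 0" for B
    using \<nu>(1) by (intro vague_limit_Jordan[OF _ \<nu>(2) _ vague that]) (simp_all add: prob_space_def)
  then show ?thesis
    using vague law prob by simp
qed

end
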